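(* Let $d\ge 1$, $0<\theta<1$, let $\mu,\lambda$ be constants with $\mu>0$ and $\lambda+\mu>0$, let $a,b$ satisfy $0<\frac{a}{2^d}<a<\frac{b}{2^d}<b$, and let the pressure $p$ satisfy $p(a/t^d)=p(b/t^d)$ for all $t\in[1,2]$. For $n\in\mathbb{N}$, $n\ge 1$, define on $Q=[1,2]\times B_1$, where $B_1\subset\mathbb{R}^d$ is the unit ball, $$\rho_n(t,y)=\begin{cases}\dfrac{a}{t^d}, & \dfrac{k}{n}<\dfrac{|y|}{t}<\dfrac{k+\theta}{n},\\[8pt] \dfrac{b}{t^d}, & \dfrac{k+\theta}{n}<\dfrac{|y|}{t}<\dfrac{k+1}{n},\end{cases}\quad k=0,1,\dots,n-1,\qquad u_n(t,y)=\frac{y}{t}.$$ Then: (i) for every $n$, $(\rho_n,u_n)$ is a weak solution on $Q$ of the compressible Navier-Stokes system $$\begin{aligned}\partial_t\rho+\operatorname{div}(\rho u)&=0,\\ \partial_t(\rho u)+\operatorname{div}(\rho u\otimes u)+\nabla p(\rho)&=\operatorname{div}\Big(\mu(\nabla u+\nabla u^T)+\lambda(\operatorname{div}u)\,I\Big);\end{aligned}$$ (ii) as $n\to\infty$, $u_n\to u=\frac{y}{t}$ strongly and $$\rho_n\rightharpoonup\rho=\theta\frac{a}{t^d}+(1-\theta)\frac{b}{t^d}\quad\text{weakly-}\star\text{ in }L^\infty(Q);$$ (iii) the Young measure associated with the sequence $\{\rho_n\}$ is $\nu=\theta\,\delta_{a/t^d}+(1-\theta)\,\delta_{b/t^d}$;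 (iv) $p(\rho_n)\rightharpoonup q$ weakly-$\star$ in $L^\infty(Q)$ for some $q$, and in general $q\neq p(\rho)$, i.e. there are choices of $a,b,\theta,p$ with $0<\theta<1$, $0<\frac{a}{2^d}<a<\frac{b}{2^d}<b$ and $p(a/t^d)=p(b/t^d)$ for all $t\in[1,2]$, for which $q\ne p(\rho)$.
   Context: $p:(0,\infty)\to\mathbb{R}$ is a given continuous function of the density; $I$ is the $d\times d$ identity matrix. The functions $\rho_n$ are defined almost everywhere on $Q$. "Weak solution on $Q$" means that both equations hold in the sense of distributions in the interior of $Q$. The Young measure of a bounded sequence $\{\rho_n\}$ is the family of probability measures $\nu_{t,y}$ such that $\beta(\rho_n)\rightharpoonup\int\beta\,d\nu_{t,y}$ weakly-$\star$ in $L^\infty(Q)$ for every continuous $\beta$. *)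

theory Defs
  imports "HOL-Probability.Probability"
begin

definition dir_deriv :: "'a::real_normed_vector \<Rightarrow> ('a \<Rightarrow> real) \<Rightarrow> 'a \<Rightarrow> real" where
  "dir_deriv v \<phi> x = frechet_derivative \<phi> (at x) v"

primrec Ck :: "nat \<Rightarrow> ('a::real_normed_vector \<Rightarrow> real) \<Rightarrow> bool" where
  "Ck 0 \<phi> \<longleftrightarrow> continuous_on UNIV \<phi>"
| "Ck (Suc k) \<phi> \<longleftrightarrow> (\<forall>x. \<phi> differentiable (at x)) \<and> (\<forall>v. Ck k (dir_deriv v \<phi>))"

definition test_functions :: "'a::euclidean_space set \<Rightarrow> ('a \<Rightarrow> real) set" where
  "test_functions \<Omega> =
     {\<phi>. (\<forall>k. Ck k \<phi>) \<and> compact (closure {x. \<phi> x \<noteq> 0}) \<and> closure {x. \<phi> x \<noteq> 0} \<subseteq> \<Omega>}"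

definition locally_integrable :: "'a::euclidean_space set \<Rightarrow> ('a \<Rightarrow> real) \<Rightarrow> bool" where
  "locally_integrable \<Omega> f \<longleftrightarrow> (\<forall>K. compact K \<and> K \<subseteq> \<Omega> \<longrightarrow> integrable (lebesgue_on K) f)"

text \<open>Distributions on \<open>\<Omega>\<close> are represented by functionals on functions; only their values on
  \<open>test_functions \<Omega>\<close> matter.\<close>

definition dist_of :: "'a::euclidean_space set \<Rightarrow> ('a \<Rightarrow> real) \<Rightarrow> ('a \<Rightarrow> real) \<Rightarrow> real" where
  "dist_of \<Omega> f = (\<lambda>\<phi>. LINT x|lebesgue_on \<Omega>. f x * \<phi> x)"

definition dist_deriv ::
  "'a::euclidean_space \<Rightarrow> (('a \<Rightarrow> real) \<Rightarrow> real) \<Rightarrow> ('a \<Rightarrow> real) \<Rightarrow> real" where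
  "dist_deriv v T = (\<lambda>\<phi>. - T (dir_deriv v \<phi>))"

abbreviation e_t :: "real \<times> (real^'d)" where
  "e_t \<equiv> (1, 0)"

abbreviation e_y :: "'d \<Rightarrow> real \<times> (real^'d)" where
  "e_y i \<equiv> (0, axis i 1)"

text \<open>The \<open>(i, j)\<close> entry of the viscous stress
  \<open>\<mu> (\<nabla>u + \<nabla>u\<^sup>T) + \<lambda> (div u) I\<close>, with all derivatives distributional.\<close>

definition viscous_stress ::
  "(real \<times> (real^'d)) set \<Rightarrow> real \<Rightarrow> real \<Rightarrow> (real \<times> (real^'d) \<Rightarrow> real^'d) \<Rightarrow> 'd \<Rightarrow> 'd
    \<Rightarrow> (real \<times> (real^'d) \<Rightarrow> real) \<Rightarrow> real" where
  "viscous_stress \<Omega> \<mu> lam u i j = (\<lambda>\<phi>.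
     \<mu> * (dist_deriv (e_y j) (dist_of \<Omega> (\<lambda>x. u x $ i)) \<phi>
          + dist_deriv (e_y i) (dist_of \<Omega> (\<lambda>x. u x $ j)) \<phi>)
     + lam * (\<Sum>k\<in>UNIV. dist_deriv (e_y k) (dist_of \<Omega> (\<lambda>x. u x $ k)) \<phi>) * (if i = j then 1 else 0))"

text \<open>The positivity and local integrability conditions ensure that \<open>p (\<rho>)\<close> is meaningful for a
  pressure defined on \<open>(0, \<infinity>)\<close> and that all terms are distributions on \<open>\<Omega>\<close>.\<close>

definition weak_solution_NS ::
  "(real \<times> (real^'d)) set \<Rightarrow> real \<Rightarrow> real \<Rightarrow> (real \<Rightarrow> real)
    \<Rightarrow> (real \<times> (real^'d) \<Rightarrow> real) \<Rightarrow> (real \<times> (real^'d) \<Rightarrow> real^'d) \<Rightarrow> bool" where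
  "weak_solution_NS \<Omega> \<mu> lam p \<rho> u \<longleftrightarrow>
     (AE x in lebesgue_on \<Omega>. \<rho> x > 0) \<and>
     locally_integrable \<Omega> \<rho> \<and>
     locally_integrable \<Omega> (\<lambda>x. p (\<rho> x)) \<and>
     (\<forall>i. locally_integrable \<Omega> (\<lambda>x. u x $ i)) \<and>
     (\<forall>i. locally_integrable \<Omega> (\<lambda>x. \<rho> x * u x $ i)) \<and>
     (\<forall>i j. locally_integrable \<Omega> (\<lambda>x. \<rho> x * u x $ i * u x $ j)) \<and>
     (\<forall>\<phi>\<in>test_functions \<Omega>.
        dist_deriv e_t (dist_of \<Omega> \<rho>) \<phi>
        + (\<Sum>j\<in>UNIV. dist_deriv (e_y j) (dist_of \<Omega> (\<lambda>x. \<rho> x * u x $ j)) \<phi>) = 0) \<and>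
     (\<forall>\<phi>\<in>test_functions \<Omega>. \<forall>i.
        dist_deriv e_t (dist_of \<Omega> (\<lambda>x. \<rho> x * u x $ i)) \<phi>
        + (\<Sum>j\<in>UNIV. dist_deriv (e_y j) (dist_of \<Omega> (\<lambda>x. \<rho> x * u x $ i * u x $ j)) \<phi>)
        + dist_deriv (e_y i) (dist_of \<Omega> (\<lambda>x. p (\<rho> x))) \<phi>
        = (\<Sum>j\<in>UNIV. dist_deriv (e_y j) (viscous_stress \<Omega> \<mu> lam u i j) \<phi>))"

definition Linf_norm :: "'a::euclidean_space set \<Rightarrow> ('a \<Rightarrow> 'b::euclidean_space) \<Rightarrow> ereal" where
  "Linf_norm S f = esssup (lebesgue_on S) (\<lambda>x. ereal (norm (f x)))"

definition Linf :: "'a::euclidean_space set \<Rightarrow> ('a \<Rightarrow> 'b::euclidean_space) set" where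
  "Linf S = {f \<in> borel_measurable (lebesgue_on S). Linf_norm S f < \<infinity>}"

definition Linf_strong_lim ::
  "'a::euclidean_space set \<Rightarrow> (nat \<Rightarrow> 'a \<Rightarrow> 'b::euclidean_space) \<Rightarrow> ('a \<Rightarrow> 'b) \<Rightarrow> bool" where
  "Linf_strong_lim S f g \<longleftrightarrow>
     (\<forall>n. f n \<in> Linf S) \<and> g \<in> Linf S \<and> (\<lambda>n. Linf_norm S (\<lambda>x. f n x - g x)) \<longlonglongrightarrow> 0"

definition Linf_weak_star_lim ::
  "'a::euclidean_space set \<Rightarrow> (nat \<Rightarrow> 'a \<Rightarrow> real) \<Rightarrow> ('a \<Rightarrow> real) \<Rightarrow> bool" where
  "Linf_weak_star_lim S f g \<longleftrightarrow>
     (\<forall>n. f n \<in> Linf S) \<and> g \<in> Linf S \<and>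
     (\<forall>h. integrable (lebesgue_on S) h \<longrightarrow>
        (\<lambda>n. LINT x|lebesgue_on S. f n x * h x) \<longlonglongrightarrow> (LINT x|lebesgue_on S. g x * h x))"

text \<open>The integrability clause prevents a Bochner integral of a non-integrable \<open>\<beta>\<close> from
  defaulting to \<open>0\<close>.\<close>

definition is_young_measure ::
  "'a::euclidean_space set \<Rightarrow> (nat \<Rightarrow> 'a \<Rightarrow> real) \<Rightarrow> ('a \<Rightarrow> real measure) \<Rightarrow> bool" where
  "is_young_measure S f \<nu> \<longleftrightarrow>
     (\<exists>C::real. \<forall>n. Linf_norm S (f n) \<le> ereal C) \<and>
     (AE x in lebesgue_on S. prob_space (\<nu> x) \<and> sets (\<nu> x) = sets borel) \<and>
     (\<forall>\<beta>::real \<Rightarrow> real. continuous_on UNIV \<beta> \<longrightarrow>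
        (AE x in lebesgue_on S. integrable (\<nu> x) \<beta>) \<and>
        Linf_weak_star_lim S (\<lambda>n x. \<beta> (f n x)) (\<lambda>x. LINT s|\<nu> x. \<beta> s))"

definition dirac_mix :: "real \<Rightarrow> real \<Rightarrow> real \<Rightarrow> real measure" where
  "dirac_mix \<theta> r s = measure_of UNIV (sets borel)
     (\<lambda>A. ennreal \<theta> * emeasure (return borel r) A + ennreal (1 - \<theta>) * emeasure (return borel s) A)"

definition Q :: "(real \<times> (real^'d)) set" where
  "Q = {1..2} \<times> ball 0 1"

definition admissible :: "nat \<Rightarrow> real \<Rightarrow> real \<Rightarrow> real \<Rightarrow> (real \<Rightarrow> real) \<Rightarrow> bool" where
  "admissible d \<theta> a b p \<longleftrightarrow>
     0 < \<theta> \<and> \<theta> < 1 \<and>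
     0 < a / 2 ^ d \<and> a / 2 ^ d < a \<and> a < b / 2 ^ d \<and> b / 2 ^ d < b \<and>
     continuous_on {0<..} p \<and> (\<forall>t\<in>{1..2}. p (a / t ^ d) = p (b / t ^ d))"

text \<open>The value is left unspecified on the null set of interfaces.\<close>

definition rho_n :: "real \<Rightarrow> real \<Rightarrow> real \<Rightarrow> nat \<Rightarrow> real \<times> (real^'d) \<Rightarrow> real" where
  "rho_n \<theta> a b n = (\<lambda>(t, y).
     if \<exists>k<n. real k / real n < norm y / t \<and> norm y / t < (real k + \<theta>) / real n
     then a / t ^ CARD('d)
     else if \<exists>k<n. (real k + \<theta>) / real n < norm y / t \<and> norm y / t < (real k + 1) / real n
     then b / t ^ CARD('d)
     else undefined)"

definition u_n :: "nat \<Rightarrow> real \<times> (real^'d) \<Rightarrow> real^'d" where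
  "u_n n = (\<lambda>(t, y). y /\<^sub>R t)"

definition rho_lim :: "real \<Rightarrow> real \<Rightarrow> real \<Rightarrow> real \<times> (real^'d) \<Rightarrow> real" where
  "rho_lim \<theta> a b = (\<lambda>(t, y). \<theta> * (a / t ^ CARD('d)) + (1 - \<theta>) * (b / t ^ CARD('d)))"

definition u_lim :: "real \<times> (real^'d) \<Rightarrow> real^'d" where
  "u_lim = (\<lambda>(t, y). y /\<^sub>R t)"

definition nu_lim :: "real \<Rightarrow> real \<Rightarrow> real \<Rightarrow> real \<times> (real^'d) \<Rightarrow> real measure" where
  "nu_lim \<theta> a b = (\<lambda>(t, y). dirac_mix \<theta> (a / t ^ CARD('d)) (b / t ^ CARD('d)))"

end

theory Submission
  imports Defs
begin

text \<open>Everything is constant along the flow lines \<open>y = t z\<close>. In the coordinates \<open>(t, z)\<close> the density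
  is \<open>c(z) / t\<^sup>d\<close>, so the transport parts of both equations are integrals of a pure
  \<open>t\<close>-derivative. The assumption on the pressure makes \<open>p(\<rho>\<^sub>n)\<close> a function of \<open>t\<close> alone, so its
  gradient vanishes, and the viscous stress of the linear field \<open>y / t\<close> depends on \<open>t\<close> only.

  For the limits, \<open>\<beta>(\<rho>\<^sub>n)\<close> is its claimed limit plus a fixed function times
  \<open>w(n|y|/t)\<close>, where \<open>w\<close> is a periodic square wave of mean zero. A Dynkin argument reduces the
  weak-star convergence of \<open>w(n|y|/t)\<close> to \<open>0\<close> to integrals over boxes, and there, for fixed
  \<open>y \<noteq> 0\<close>, the integral in \<open>t\<close> over an interval is \<open>O(1 / (n|y|))\<close>.\<close>

section \<open>Weak convergence of the oscillation\<close>

text \<open>\<open>rho_n\<close> jumps across the cones |y|/t = const, so the equations cannot be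
  checked by differentiating it. The transport terms are instead rewritten so that the derivative
  acts along a direction in which the rough factor is constant: the time direction at fixed z. For
  the pressure it is a spatial direction at fixed t. The profile then only has to be bounded and
  Borel, and translation invariance replaces integration by parts. The momentum follows from the
  mass balance: z = y/t is constant along each ray, so \<rho> u_i is again of the form c(z)/t^d,
  with c(z) z_i in place of c(z). On the cones \<open>rho_n\<close> is unspecified, which forces
  almost-everywhere identities and passages between Borel and Lebesgue measurable functions. For the
  limits the decay is sought in t rather than in |y|: at fixed y the phase n|y|/t sweeps through
  many periods as t varies, so a one-dimensional estimate and Fubini suffice in every dimension.
  Identifying the Young measure also requires uniqueness. Each \<beta> comes with its own
  exceptional null set, so a countable family of functions \<beta> has to determine the
  measure.\<close>

text \<open>The library version is restricted to measures on Euclidean spaces.\<close>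

lemma abs_lebesgue_integral_le:
  fixes f g :: "'a \<Rightarrow> real"
  assumes "integrable M f" "integrable M g" "\<And>x. x \<in> space M \<Longrightarrow> \<bar>f x\<bar> \<le> g x"
  shows "\<bar>LINT x|M. f x\<bar> \<le> (LINT x|M. g x)"
proof -
  have "\<bar>LINT x|M. f x\<bar> \<le> (LINT x|M. \<bar>f x\<bar>)" by (rule integral_abs_bound)
  also have "\<dots> \<le> (LINT x|M. g x)" using assms by (intro integral_mono) auto
  finally show ?thesis .
qed

text \<open>The sets tested successfully form a Dynkin system: complements use
  \<open>lim_space\<close>, disjoint unions use the uniform bound. Linearity then gives simple
  functions, and L1 approximation gives every integrable g, with an error that \<open>B\<close>
  controls uniformly in n.\<close>

lemma weak_null_of_generator:
  fixes f :: "nat \<Rightarrow> 'a \<Rightarrow> real"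
  assumes "finite_measure M" and "Int_stable E" and "E \<subseteq> Pow (space M)"
    and gen: "sets M = sigma_sets (space M) E"
    and meas [measurable]: "\<And>n. f n \<in> borel_measurable M"
    and bound: "\<And>n x. \<bar>f n x\<bar> \<le> B"
    and lim_E: "\<And>A. A \<in> E \<Longrightarrow> (\<lambda>n. LINT x|M. f n x * indicator A x) \<longlonglongrightarrow> 0"
    and lim_space: "(\<lambda>n. LINT x|M. f n x) \<longlonglongrightarrow> 0"
    and "integrable M g"
  shows "(\<lambda>n. LINT x|M. f n x * g x) \<longlonglongrightarrow> 0"
proof -
  interpret finite_measure M by fact
  have B: "0 \<le> B" using bound[of 0 undefined] by linarith
  have int_mult: "integrable M (\<lambda>x. f n x * h x)" if [measurable]: "integrable M h" for h n
  proof (rule Bochner_Integration.integrable_bound)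
    show "integrable M (\<lambda>x. B * h x)" using that by simp
    show "AE x in M. norm (f n x * h x) \<le> norm (B * h x)"
      using bound B by (intro AE_I2) (simp add: abs_mult mult_right_mono)
  qed simp
  have int_f: "integrable M (f n)" for n
    using int_mult[of "\<lambda>_. 1" n] by simp
  have int_ind: "integrable M (\<lambda>x. f n x * indicator A x)" if "A \<in> sets M" for A n
    using that by (intro int_mult) (simp add: emeasure_finite less_top[symmetric])
  have sets_lim: "(\<lambda>n. LINT x|M. f n x * indicator A x) \<longlonglongrightarrow> 0" if "A \<in> sets M" for A
  proof -
    from that have "A \<in> sigma_sets (space M) E" using gen by simp
    then show ?thesis
    proof (induction rule: sigma_sets_induct_disjoint[OF \<open>Int_stable E\<close> \<open>E \<subseteq> Pow (space M)\<close>,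
        consumes 1, case_names basic empty compl union])
      case (basic A) then show ?case by (rule lim_E)
    next
      case empty then show ?case by simp
    next
      case (compl A)
      then have A: "A \<in> sets M" using gen by simp
      have "(LINT x|M. f n x * indicator (space M - A) x)
          = (LINT x|M. f n x) - (LINT x|M. f n x * indicator A x)" for n
        unfolding Bochner_Integration.integral_diff[OF int_f int_ind[OF A], symmetric]
        by (rule Bochner_Integration.integral_cong) (auto simp: indicator_def)
      then show ?case using tendsto_diff[OF lim_space compl(2)] by simp
    next
      case (union A)
      then have A: "A i \<in> sets M" for i using gen by (metis UNIV_I image_subset_iff)
      have sm: "(\<lambda>i. measure M (A i)) sums measure M (\<Union>i. A i)"
        using A union(1) by (intro finite_measure_UNION) auto
      have bnd: "\<bar>LINT x|M. f n x * indicator (A i) x\<bar> \<le> B * measure M (A i)" for n i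
      proof -
        have "\<bar>LINT x|M. f n x * indicator (A i) x\<bar> \<le> (LINT x|M. B * indicator (A i) x)"
          using A bound B
          by (intro abs_lebesgue_integral_le int_ind)
             (auto simp: emeasure_finite less_top[symmetric] abs_mult intro: mult_right_mono)
        also have "\<dots> = B * measure M (A i)" using A by simp
        finally show ?thesis .
      qed
      have eq: "(LINT x|M. f n x * indicator (\<Union>i. A i) x)
          = (\<Sum>i. LINT x|M. f n x * indicator (A i) x)" for n
      proof -
        have "(LINT x:(\<Union>i. A i)|M. f n x) = (\<Sum>i. LINT x:A i|M. f n x)"
        proof (rule lebesgue_integral_countable_add)
          show "set_integrable M (\<Union>i. A i) (f n)"
            using int_ind[of "\<Union>i. A i" n] A by (simp add: set_integrable_def mult.commute)
        qed (use A union(1) in \<open>auto simp: disjoint_family_on_def\<close>)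
        then show ?thesis by (simp add: set_lebesgue_integral_def mult.commute)
      qed
      \<comment> \<open>Limit and series may be exchanged because the i-th term is at most B times
        the measure of A i for every n, and these bounds are summable as the measure is
        finite.\<close>
      have "(\<lambda>n. \<Sum>i. LINT x|M. f n x * indicator (A i) x) \<longlonglongrightarrow> (\<Sum>i. 0)"
        by (intro conjunct2[OF conjunct2[OF tannerys_theorem[where M="\<lambda>i. B * measure M (A i)"]]]
              union always_eventually summable_mult sums_summable[OF sm])
           (simp_all add: bnd case_prod_beta)
      then show ?case by (simp add: eq)
    qed
  qed
  show ?thesis using \<open>integrable M g\<close>
  proof (induction rule: integrable_induct)
    case (base A c)
    have "(\<lambda>n. (LINT x|M. f n x * indicator A x) * c) \<longlonglongrightarrow> 0 * c"
      using base by (intro tendsto_mult sets_lim) auto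
    then show ?case
      by (simp add: mult.assoc[symmetric] flip: Bochner_Integration.integral_mult_left_zero)
  next
    case (add h1 h2)
    then show ?case
      using tendsto_add[OF add(3,4)] by (simp add: distrib_left int_mult)
  next
    case (lim h s)
    \<comment> \<open>The induction rule supplies approximants with |s i| \<le> 2|h|, hence the
      majorant 3|h|.\<close>
    have s_L1: "(\<lambda>i. LINT x|M. \<bar>s i x - h x\<bar>) \<longlonglongrightarrow> (LINT x|M. 0)"
    proof (rule integral_dominated_convergence)
      show "integrable M (\<lambda>x. 3 * \<bar>h x\<bar>)" using lim by simp
      show "AE x in M. (\<lambda>i. \<bar>s i x - h x\<bar>) \<longlonglongrightarrow> 0"
      proof (rule AE_I2)
        fix x assume "x \<in> space M"
        then have "(\<lambda>i. s i x - h x) \<longlonglongrightarrow> h x - h x" using lim by (intro tendsto_intros) auto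
        then show "(\<lambda>i. \<bar>s i x - h x\<bar>) \<longlonglongrightarrow> 0" by (simp add: tendsto_rabs_zero)
      qed
      show "AE x in M. norm \<bar>s i x - h x\<bar> \<le> 3 * \<bar>h x\<bar>" for i
      proof (rule AE_I2)
        fix x assume "x \<in> space M"
        then have "\<bar>s i x\<bar> \<le> 2 * \<bar>h x\<bar>" using lim by auto
        then show "norm \<bar>s i x - h x\<bar> \<le> 3 * \<bar>h x\<bar>" by simp
      qed
    qed (use lim in auto)
    show ?case
    proof (rule LIMSEQ_I)
      fix r :: real assume "0 < r"
      have "(\<lambda>i. B * (LINT x|M. \<bar>s i x - h x\<bar>)) \<longlonglongrightarrow> 0"
        using tendsto_mult[OF tendsto_const s_L1] by simp
      then have "\<forall>\<^sub>F i in sequentially. B * (LINT x|M. \<bar>s i x - h x\<bar>) < r / 2"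
        using \<open>0 < r\<close> by (intro order_tendstoD) auto
      \<comment> \<open>The index i is fixed before n, so that the approximation error is below r/2
        for all n at once.\<close>
      then obtain i where i: "B * (LINT x|M. \<bar>s i x - h x\<bar>) < r / 2"
        by (auto simp: eventually_sequentially)
      obtain N where N: "\<And>n. n \<ge> N \<Longrightarrow> \<bar>LINT x|M. f n x * s i x\<bar> < r / 2"
        using LIMSEQ_D[OF lim.IH[of i], of "r / 2"] \<open>0 < r\<close> by auto
      have "\<bar>LINT x|M. f n x * h x\<bar> < r" if "n \<ge> N" for n
      proof -
        have "(LINT x|M. f n x * s i x) - (LINT x|M. f n x * h x)
            = (LINT x|M. f n x * (s i x - h x))"
          using lim by (simp add: right_diff_distrib int_mult)
        moreover have "\<bar>LINT x|M. f n x * (s i x - h x)\<bar> \<le> (LINT x|M. B * \<bar>s i x - h x\<bar>)"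
          using lim bound
          by (intro abs_lebesgue_integral_le int_mult) (auto simp: abs_mult intro: mult_right_mono)
        ultimately show ?thesis using i N[OF that] by simp
      qed
      then show "\<exists>no. \<forall>n\<ge>no. norm ((LINT x|M. f n x * h x) - 0) < r" by auto
    qed
  qed
qed

text \<open>The periodic primitive of \<open>square_wave\<close> below.\<close>

definition tent :: "real \<Rightarrow> real \<Rightarrow> real" where
  "tent \<theta> s = min ((1 - \<theta>) * frac s) (\<theta> * (1 - frac s))"

text \<open>The indicator of the first phase minus its mean \<theta>. Choosing \<alpha>1 or
  \<alpha>2 by phase is then the same as \<theta> \<alpha>1 + (1 - \<theta>) \<alpha>2 plus the wave
  times \<alpha>1 - \<alpha>2.\<close>

definition square_wave :: "real \<Rightarrow> real \<Rightarrow> real" where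
  "square_wave \<theta> s = (if frac s < \<theta> then 1 - \<theta> else - \<theta>)"

lemma square_wave_measurable [measurable]: "square_wave \<theta> \<in> borel_measurable borel"
  unfolding square_wave_def frac_def by measurable

lemma abs_square_wave_le: "0 < \<theta> \<Longrightarrow> \<theta> < 1 \<Longrightarrow> \<bar>square_wave \<theta> s\<bar> \<le> 1"
  by (auto simp: square_wave_def)

context
  fixes \<theta> :: real
  assumes theta: "0 < \<theta>" "\<theta> < 1"
begin

lemma tent_bounds: "0 \<le> tent \<theta> s" "tent \<theta> s \<le> 1"
proof -
  show "0 \<le> tent \<theta> s" using theta frac_lt_1[of s] by (auto simp: tent_def)
  have "(1 - \<theta>) * frac s \<le> 1 * 1"
    using theta frac_lt_1[of s] by (intro mult_mono) auto
  then show "tent \<theta> s \<le> 1" by (simp add: tent_def)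
qed

text \<open>Inside one period both branches have slope at most 1 in modulus. Across an integer,
  where the tent vanishes, each value is bounded by the distance to that integer. The estimate
  serves to give continuity at the kinks.\<close>

lemma tent_lipschitz: "\<bar>tent \<theta> s - tent \<theta> t\<bar> \<le> \<bar>s - t\<bar>"
proof (induction s t rule: linorder_wlog)
  case (le s t)
  have le1: "(1 - \<theta>) * x \<le> x" "\<theta> * x \<le> x" if "0 \<le> x" for x
    using theta that by (auto simp: algebra_simps mult_left_le_one_le)
  show ?case
  proof (cases "\<lfloor>s\<rfloor> = \<lfloor>t\<rfloor>")
    case True
    then have "frac t - frac s = t - s" by (simp add: frac_def)
    moreover have "(1 - \<theta>) * (t - s) \<le> t - s" "\<theta> * (t - s) \<le> t - s"
      using le1[of "t - s"] le by auto
    moreover have "(1 - \<theta>) * frac t - (1 - \<theta>) * frac s = (1 - \<theta>) * (frac t - frac s)"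
      "\<theta> * (1 - frac s) - \<theta> * (1 - frac t) = \<theta> * (frac t - frac s)"
      by (simp_all add: algebra_simps)
    moreover have "0 \<le> (1 - \<theta>) * (t - s)" "0 \<le> \<theta> * (t - s)" using theta le by auto
    ultimately show ?thesis using le unfolding tent_def by (auto simp: min_def abs_if)
  next
    case False
    with le have "\<lfloor>s\<rfloor> + 1 \<le> \<lfloor>t\<rfloor>" using floor_mono[of s t] by linarith
    then have "real_of_int \<lfloor>s\<rfloor> + 1 \<le> real_of_int \<lfloor>t\<rfloor>" by linarith
    then have "1 - frac s \<le> t - s" "frac t \<le> t - s"
      unfolding frac_def by linarith+
    moreover have "tent \<theta> s \<le> 1 - frac s" "tent \<theta> t \<le> frac t"
      using le1[of "1 - frac s"] le1[of "frac t"] frac_lt_1[of s]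
      by (auto simp: tent_def min_le_iff_disj)
    ultimately show ?thesis using tent_bounds[of s] tent_bounds[of t] le by (simp add: abs_if)
  qed
next
  case (sym s t) then show ?case by (simp add: abs_minus_commute)
qed

lemma continuous_tent: "continuous_on A (tent \<theta>)"
  by (rule lipschitz_on_continuous_on[of 1], rule lipschitz_onI)
     (auto simp: dist_real_def intro: tent_lipschitz)

text \<open>On the open intervals (k, k + \<theta>) and (k + \<theta>, k + 1) one branch of the
  minimum is active throughout, so the tent is locally affine. The two branches meet exactly where
  the fractional part equals \<theta>.\<close>

lemma tent_deriv:
  assumes "s \<notin> \<int>" "s - \<theta> \<notin> \<int>"
  shows "(tent \<theta> has_real_derivative square_wave \<theta> s) (at s)"
proof -
  let ?k = "real_of_int \<lfloor>s\<rfloor>"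
  have k: "?k < s" "s < ?k + 1" "s \<noteq> ?k + \<theta>"
  proof -
    show "?k < s" using assms(1) by (metis Ints_of_int of_int_floor_le order_le_imp_less_or_eq)
    show "s \<noteq> ?k + \<theta>" using assms(2) by (metis Ints_of_int add_diff_cancel_right')
  qed linarith
  have fr: "frac x = x - ?k" if "?k < x" "x < ?k + 1" for x
    using that by (simp add: frac_unique_iff)
  show ?thesis
  proof (cases "s < ?k + \<theta>")
    case True
    have "((\<lambda>x. (1 - \<theta>) * (x - ?k)) has_real_derivative square_wave \<theta> s) (at s)"
      using True fr[of s] k by (auto intro!: derivative_eq_intros simp: square_wave_def)
    then show ?thesis
    proof (rule has_field_derivative_transform_within_open)
      fix x assume x: "x \<in> {?k<..<?k + \<theta>}"
      then have "frac x = x - ?k" using theta by (intro fr) auto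
      moreover have "(1 - \<theta>) * (x - ?k) \<le> \<theta> * (1 - (x - ?k))"
        using x by (simp add: algebra_simps)
      ultimately show "(1 - \<theta>) * (x - ?k) = tent \<theta> x" by (simp add: tent_def)
    qed (use k True in auto)
  next
    case False
    have "((\<lambda>x. \<theta> * (1 - (x - ?k))) has_real_derivative square_wave \<theta> s) (at s)"
      using False fr[of s] k by (auto intro!: derivative_eq_intros simp: square_wave_def)
    then show ?thesis
    proof (rule has_field_derivative_transform_within_open)
      fix x assume x: "x \<in> {?k + \<theta><..<?k + 1}"
      then have "frac x = x - ?k" using theta by (intro fr) auto
      moreover have "\<theta> * (1 - (x - ?k)) \<le> (1 - \<theta>) * (x - ?k)"
        using x by (simp add: algebra_simps)
      ultimately show "\<theta> * (1 - (x - ?k)) = tent \<theta> x" by (simp add: tent_def)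
    qed (use k False in auto)
  qed
qed

text \<open>Up to a term of size \<open>1/r\<close>, the integrand is the derivative of \<open>- t\<^sup>2 tent(r/t) / r\<close>.\<close>

lemma square_wave_reciprocal_has_integral:
  assumes "1 \<le> c" "c \<le> e" "e \<le> 2" "0 < r"
  obtains I where "((\<lambda>t. square_wave \<theta> (r / t)) has_integral I) {c..e}" "\<bar>I\<bar> \<le> 12 / r"
proof -
  let ?F = "\<lambda>t. - (t\<^sup>2 * tent \<theta> (r / t) / r)"
  let ?G = "\<lambda>t. 2 * t * tent \<theta> (r / t) / r"
  \<comment> \<open>The times at which r/t meets a kink of the tent. As t \<ge> 1, 0 < r/t \<le> r,
    so finitely many indices suffice; -1 is a safe lower end for the second family because r/t -
    \<theta> > -1.\<close>
  let ?S = "(\<lambda>k. r / of_int k) ` {0..\<lceil>r\<rceil>} \<union> (\<lambda>k. r / (of_int k + \<theta>)) ` {-1..\<lceil>r\<rceil>}"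
  have cont: "continuous_on {c..e} (\<lambda>t. tent \<theta> (r / t))"
    using assms by (intro continuous_on_compose2[OF continuous_tent[of UNIV]] continuous_intros) auto
  have FTC: "((\<lambda>t. square_wave \<theta> (r / t) - ?G t) has_integral (?F e - ?F c)) {c..e}"
  proof (rule fundamental_theorem_of_calculus_strong)
    show "finite ?S" by simp
    show "continuous_on {c..e} ?F" by (intro continuous_intros cont) (use assms in auto)
    fix t assume t: "t \<in> {c..e} - ?S"
    then have t0: "1 \<le> t" using assms by simp
    have le: "0 < r / t" "r / t \<le> r"
      using t0 assms by (auto simp: divide_le_eq mult_le_cancel_left1)
    have tr: "t = r / (r / t)" using t0 assms by simp
    have "r / t \<notin> \<int>"
    proof
      assume "r / t \<in> \<int>"
      then obtain k where k: "r / t = of_int k" by (auto elim: Ints_cases)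
      then have "0 \<le> k" "k \<le> \<lceil>r\<rceil>" using le by linarith+
      moreover have "t = r / of_int k" using tr unfolding k .
      ultimately show False using t by auto
    qed
    moreover have "r / t - \<theta> \<notin> \<int>"
    proof
      assume "r / t - \<theta> \<in> \<int>"
      then obtain k where "r / t - \<theta> = of_int k" by (auto elim: Ints_cases)
      then have k: "r / t = of_int k + \<theta>" by simp
      then have "-1 \<le> k" "k \<le> \<lceil>r\<rceil>" using le theta by linarith+
      moreover have "t = r / (of_int k + \<theta>)" using tr unfolding k .
      ultimately show False using t by auto
    qed
    ultimately have "(tent \<theta> has_real_derivative square_wave \<theta> (r / t)) (at (r / t))"
      by (rule tent_deriv)
    moreover have "((\<lambda>t. r / t) has_real_derivative - (r / t\<^sup>2)) (at t)"
      using t0 by (auto intro!: derivative_eq_intros simp: power2_eq_square)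
    ultimately have D: "((\<lambda>t. tent \<theta> (r / t)) has_real_derivative
        square_wave \<theta> (r / t) * - (r / t\<^sup>2)) (at t)"
      by (rule DERIV_chain2)
    have "((\<lambda>t::real. t\<^sup>2) has_real_derivative 2 * t) (at t)"
      by (auto intro!: derivative_eq_intros)
    from DERIV_minus[OF DERIV_cdivide[OF DERIV_mult[OF this D], of r]]
    have "(?F has_real_derivative - ((2 * t * tent \<theta> (r / t)
        + square_wave \<theta> (r / t) * - (r / t\<^sup>2) * t\<^sup>2) / r)) (at t)"
      by simp
    also have "- ((2 * t * tent \<theta> (r / t)
        + square_wave \<theta> (r / t) * - (r / t\<^sup>2) * t\<^sup>2) / r) = square_wave \<theta> (r / t) - ?G t"
      using t0 assms by (simp add: add_divide_distrib diff_divide_distrib)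
    finally have "(?F has_real_derivative square_wave \<theta> (r / t) - ?G t) (at t)" .
    then show "(?F has_vector_derivative square_wave \<theta> (r / t) - ?G t) (at t)"
      by (simp add: has_real_derivative_iff_has_vector_derivative)
  qed (use assms in auto)
  have "?G integrable_on {c..e}"
    using assms by (intro integrable_continuous_real continuous_intros cont) auto
  from has_integral_add[OF FTC integrable_integral[OF this]]
  have I: "((\<lambda>t. square_wave \<theta> (r / t)) has_integral
      (?F e - ?F c + integral {c..e} ?G)) {c..e}"
    by simp
  have Fb: "\<bar>?F t\<bar> \<le> 4 / r" if "t \<in> {c..e}" for t
  proof -
    have "t\<^sup>2 \<le> 2\<^sup>2" using that assms by (intro power_mono) auto
    then have "t\<^sup>2 * tent \<theta> (r / t) \<le> 4 * 1" using tent_bounds by (intro mult_mono) auto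
    then show ?thesis using tent_bounds[of "r / t"] assms by (simp add: divide_right_mono)
  qed
  have "norm (integral {c..e} ?G) \<le> (4 / r) * (e - c)"
  proof (rule integral_bound)
    fix t assume t: "t \<in> {c..e}"
    have "2 * t * tent \<theta> (r / t) \<le> 4 * 1"
      using tent_bounds t assms by (intro mult_mono) auto
    then show "norm (?G t) \<le> 4 / r"
      using tent_bounds[of "r / t"] t assms by (simp add: abs_mult divide_right_mono)
  qed (use assms in \<open>auto intro!: continuous_intros cont\<close>)
  also have "\<dots> \<le> (4 / r) * 1" using assms by (intro mult_left_mono) auto
  \<comment> \<open>Since t \<le> 2 and the tent lies in [0, 1], the two boundary values contribute
    4/r each, and the correction integral another 4/r over an interval of length at most 1.\<close>
  finally have "\<bar>?F e - ?F c + integral {c..e} ?G\<bar> \<le> 4 / r + 4 / r + 4 / r"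
    using Fb[of e] Fb[of c] assms(2) unfolding real_norm_def atLeastAtMost_iff by linarith
  also have "\<dots> = 12 / r" by simp
  finally show thesis using I that by blast
qed

text \<open>The time slice of an open box over a fixed y. Replacing the open interval by a closed
  one costs only its endpoints, after which the Lebesgue integral is the gauge integral already
  estimated.\<close>

lemma square_wave_slice_bound:
  assumes "0 < r"
  shows "\<bar>LINT t|lborel. indicator {1..2} t * indicator {a<..<b} t * square_wave \<theta> (r / t)\<bar>
    \<le> 12 / r"
proof (cases "max 1 a \<le> min 2 b")
  case True
  define J where "J = {max 1 a..min 2 b}"
  have J: "J \<subseteq> {1..2}" by (auto simp: J_def)
  have meas [measurable]: "(\<lambda>t. square_wave \<theta> (r / t)) \<in> borel_measurable borel"
    by measurable
  have Jm [measurable]: "J \<in> sets borel" by (simp add: J_def)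
  have "AE t in lborel. t \<noteq> a" "AE t in lborel. t \<noteq> b" by (rule AE_lborel_singleton)+
  then have "AE t in lborel. indicator {1..2} t * indicator {a<..<b} t * square_wave \<theta> (r / t)
      = indicator J t *\<^sub>R square_wave \<theta> (r / t)"
    by eventually_elim (auto simp: J_def indicator_def)
  then have "(LINT t|lborel. indicator {1..2} t * indicator {a<..<b} t * square_wave \<theta> (r / t))
      = (LINT t:J|lborel. square_wave \<theta> (r / t))"
    unfolding set_lebesgue_integral_def by (intro integral_cong_AE) auto
  moreover obtain I where I: "((\<lambda>t. square_wave \<theta> (r / t)) has_integral I) J" "\<bar>I\<bar> \<le> 12 / r"
    using square_wave_reciprocal_has_integral[of "max 1 a" "min 2 b" r] True assms
    by (auto simp: J_def)
  moreover have "set_integrable lborel J (\<lambda>t. square_wave \<theta> (r / t))"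
    unfolding set_integrable_def
    using abs_square_wave_le[OF theta]
    by (intro integrableI_bounded_set_indicator[where B=1]) (simp_all add: J_def emeasure_lborel_Icc_eq)
  ultimately show ?thesis
    using set_borel_integral_eq_integral(2)[of J "\<lambda>t. square_wave \<theta> (r / t)"]
      integral_unique[OF I(1)] by simp
next
  case False
  then have "(\<lambda>t. indicator {1..2} t * indicator {a<..<b} t * square_wave \<theta> (r / t)) = (\<lambda>t. 0)"
    by (auto simp: indicator_def fun_eq_iff)
  then show ?thesis using assms by simp
qed

end

section \<open>Integration over Q and the weak limit of the square wave\<close>

lemma integrable_bounded_support:
  fixes f :: "'a::euclidean_space \<Rightarrow> real"
  assumes [measurable]: "f \<in> borel_measurable borel" and S: "bounded S"
    and "\<And>x. x \<notin> S \<Longrightarrow> f x = 0" and "\<And>x. \<bar>f x\<bar> \<le> B"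
  shows "integrable lborel f"
proof -
  obtain R where R: "S \<subseteq> ball 0 R" using S bounded_subset_ballD by blast
  have "f = (\<lambda>x. indicator (ball 0 R) x *\<^sub>R f x)"
    using R assms(3) by (force simp: fun_eq_iff indicator_def)
  moreover have "integrable lborel (\<lambda>x. indicator (ball 0 R) x *\<^sub>R f x)"
    using assms(4) emeasure_lborel_ball_finite
    by (intro integrableI_bounded_set_indicator[where B=B]) auto
  ultimately show ?thesis by simp
qed

lemma lborel_integral_Pair:
  fixes f :: "'a::euclidean_space \<times> 'b::euclidean_space \<Rightarrow> real"
  assumes "integrable lborel f"
  shows "(LINT x|lborel. f x) = (LINT x|lborel. LINT y|lborel. f (x, y))"
    and "(LINT x|lborel. f x) = (LINT y|lborel. LINT x|lborel. f (x, y))"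
proof -
  have "integrable (lborel \<Otimes>\<^sub>M lborel) f" using assms by (simp add: lborel_prod)
  from lborel_pair.integral_fst'[OF this] lborel_pair.integral_snd[of "\<lambda>x y. f (x, y)"] this
  show "(LINT x|lborel. f x) = (LINT x|lborel. LINT y|lborel. f (x, y))"
    and "(LINT x|lborel. f x) = (LINT y|lborel. LINT x|lborel. f (x, y))"
    by (simp_all add: lborel_prod)
qed

lemma mem_box_Pair: "(x, y) \<in> box (a, c) (b, d) \<longleftrightarrow> x \<in> box a b \<and> y \<in> box c d"
  by (simp add: box_def Basis_prod_def ball_Un)

lemma Q_borel [measurable]: "(Q :: (real \<times> (real^'d)) set) \<in> sets borel"
  by (simp add: Q_def borel_prod[symmetric])

lemma bounded_Q: "bounded (Q :: (real \<times> (real^'d)) set)"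
  by (simp add: Q_def bounded_Times)

lemma emeasure_Q_finite: "emeasure lborel (Q :: (real \<times> (real^'d)) set) < \<infinity>"
  by (rule emeasure_bounded_finite[OF bounded_Q])

text \<open>For a box, Fubini with t innermost bounds the slice at y by 12 / (n|y|). This is used
  for pointwise convergence only: 1/|y| is not integrable near 0 in dimension one, so domination
  comes from the trivial bound by the indicator of the unit ball.\<close>

lemma square_wave_weak_null:
  fixes h :: "real \<times> (real^'d) \<Rightarrow> real"
  assumes theta: "0 < \<theta>" "\<theta> < 1" and h: "integrable lborel h"
  shows "(\<lambda>n. LINT x|lborel. indicator Q x *
      (square_wave \<theta> (real (Suc n) * norm (snd x) / fst x) * h x)) \<longlonglongrightarrow> 0"
proof -
  define w :: "nat \<Rightarrow> real \<times> (real^'d) \<Rightarrow> real"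
    where "w n x = square_wave \<theta> (real (Suc n) * norm (snd x) / fst x)" for n x
  \<comment> \<open>A density rather than a restriction: the measurable sets remain the Borel sets
    of the whole space, which the open boxes generate.\<close>
  define M :: "(real \<times> (real^'d)) measure"
    where "M = density lborel (\<lambda>x. ennreal (indicator Q x))"
  let ?E = "range (\<lambda>(a, b). box a b) :: (real \<times> (real^'d)) set set"
  have w_meas [measurable]: "w n \<in> borel_measurable borel" for n
    unfolding w_def borel_prod[symmetric] by measurable
  have w_bound: "\<bar>w n x\<bar> \<le> 1" for n x
    unfolding w_def by (rule abs_square_wave_le[OF theta])
  have M_int: "(LINT x|M. f x) = (LINT x|lborel. indicator Q x * f x)"
    if [measurable]: "f \<in> borel_measurable borel" for f :: "real \<times> (real^'d) \<Rightarrow> real"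
    unfolding M_def by (subst integral_density) auto
  have box_lim: "(\<lambda>n. LINT x|M. w n x * indicator (box a b) x) \<longlonglongrightarrow> 0"
    for a b :: "real \<times> (real^'d)"
  proof -
    obtain a1 a2 b1 b2 where ab: "a = (a1, a2)" "b = (b1, b2)" by fastforce
    have intg: "integrable lborel (\<lambda>x. indicator Q x * (w n x * indicator (box a b) x))" for n
      using w_bound[of n]
      by (intro integrable_bounded_support[OF _ bounded_Q, where B=1])
         (auto simp: indicator_def)
    define inner where "inner n y
      = (LINT t|lborel. indicator Q (t, y) * (w n (t, y) * indicator (box a b) (t, y)))" for n y
    have inner_eq: "inner n y = indicator (ball 0 1) y * indicator (box a2 b2) y *
      (LINT t|lborel. indicator {1..2} t * indicator {a1<..<b1} t
         * square_wave \<theta> (real (Suc n) * norm y / t))" for n y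
      unfolding inner_def ab w_def integral_mult_right_zero[symmetric]
      by (rule Bochner_Integration.integral_cong)
         (auto simp: indicator_def mem_box_Pair Q_def box_real)
    have [measurable]: "inner n \<in> borel_measurable lborel" for n
    proof -
      let ?f = "\<lambda>x. indicator Q x * (w n x * indicator (box a b) x)"
      have "?f \<in> borel_measurable borel"
        using borel_measurable_integrable[OF intg[of n]] by simp
      \<comment> \<open>The rule for measurability of a parametric integral expects the parameter,
        here y, as the first component, hence the swap.\<close>
      moreover have "(\<lambda>z::(real^'d) \<times> real. (snd z, fst z)) \<in> borel_measurable borel"
        by (intro borel_measurable_continuous_onI continuous_intros)
      ultimately have "(\<lambda>z. ?f (snd z, fst z)) \<in> borel_measurable borel"
        by (rule measurable_compose[rotated])
      then show ?thesis
        unfolding inner_def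
        by (intro lborel.borel_measurable_lebesgue_integral) (simp add: lborel_prod case_prod_beta')
    qed
    have "(\<lambda>n. LINT y|lborel. inner n y) \<longlonglongrightarrow> integral\<^sup>L lborel (\<lambda>y::real^'d. 0::real)"
    proof (rule integral_dominated_convergence)
      show "integrable lborel (\<lambda>y::real^'d. indicator (ball 0 1) y :: real)"
        by (intro integrable_bounded_support[where S="ball 0 1" and B=1])
           (auto intro!: borel_measurable_indicator borel_open split: split_indicator)
      have "AE y in lborel. y \<noteq> (0 :: real^'d)" by (rule AE_lborel_singleton)
      then show "AE y in lborel. (\<lambda>n. inner n y) \<longlonglongrightarrow> 0"
      proof eventually_elim
        case (elim y)
        have bd: "\<bar>inner n y\<bar> \<le> (12 / norm y) * (1 / real (Suc n))" for n
        proof -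
          have "\<bar>inner n y\<bar> \<le> 1 * (12 / (real (Suc n) * norm y))"
            unfolding inner_eq abs_mult
            using elim square_wave_slice_bound[OF theta, of "real (Suc n) * norm y" a1 b1]
            by (intro mult_mono) (auto simp: indicator_def)
          then show ?thesis by (simp add: mult.commute)
        qed
        have "(\<lambda>n. (12 / norm y) * (1 / real (Suc n))) \<longlonglongrightarrow> (12 / norm y) * 0"
          by (intro tendsto_mult tendsto_const LIMSEQ_Suc lim_1_over_n)
        then have "(\<lambda>n. (12 / norm y) * (1 / real (Suc n))) \<longlonglongrightarrow> 0"
          by (simp only: mult_zero_right)
        then show ?case
          by (rule Lim_null_comparison[rotated]) (simp only: real_norm_def bd eventually_True)
      qed
      show "AE y in lborel. norm (inner n y) \<le> indicator (ball 0 1) y" for n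
      proof (rule AE_I2)
        fix y :: "real^'d"
        have "\<bar>LINT t|lborel. indicator {1..2} t * indicator {a1<..<b1} t
            * square_wave \<theta> (real (Suc n) * norm y / t)\<bar> \<le> (LINT t|lborel. indicator {1..2::real} t)"
        proof (rule abs_lebesgue_integral_le)
          show "integrable lborel (\<lambda>t. indicator {1..2} t * indicator {a1<..<b1} t
              * square_wave \<theta> (real (Suc n) * norm y / t))"
            using abs_square_wave_le[OF theta]
            by (intro integrable_bounded_support[where S="{1..2}" and B=1])
               (auto simp: indicator_def)
          show "integrable lborel (indicator {1..2::real} :: real \<Rightarrow> real)"
            by (intro integrable_bounded_support[where S="{1..2}" and B=1])
               (auto split: split_indicator)
        qed (use abs_square_wave_le[OF theta] in \<open>auto split: split_indicator\<close>)
        also have "(LINT t|lborel. indicator {1..2::real} t) = (1 :: real)" by simp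
        finally show "norm (inner n y) \<le> indicator (ball 0 1) y"
          unfolding inner_eq real_norm_def abs_mult
          by (cases "y \<in> ball 0 1"; cases "y \<in> box a2 b2") simp_all
      qed
    qed simp_all
    then show ?thesis
      using lborel_integral_Pair(2)[OF intg] by (simp add: M_int inner_def)
  qed
  have "(\<lambda>n. LINT x|M. w n x * h x) \<longlonglongrightarrow> 0"
  proof (rule weak_null_of_generator)
    show "finite_measure M"
      using emeasure_Q_finite
      by (intro finite_measureI) (simp add: M_def emeasure_density ennreal_indicator less_top)
    show "Int_stable ?E" by (auto simp: Int_stable_def box_Int_box)
    show "sets M = sigma_sets (space M) ?E"
      by (simp add: M_def borel_eq_box)
    show "w n \<in> borel_measurable M" for n by (simp add: M_def)
    show "integrable M h"
      using integrable_mult_indicator[of Q lborel h] h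
      by (simp add: M_def integrable_density borel_measurable_integrable)
    \<comment> \<open>The whole space is not a box, but Q is bounded, so one large box already
      carries all of \<open>M\<close>.\<close>
    obtain c where c: "Q \<subseteq> box (- c) (c :: real \<times> (real^'d))"
      using bounded_subset_box_symmetric[OF bounded_Q] by blast
    have "(LINT x|M. w n x) = (LINT x|M. w n x * indicator (box (- c) c) x)" for n
      unfolding M_int[OF w_meas]
      by (subst M_int, measurable, rule Bochner_Integration.integral_cong)
         (use c in \<open>auto simp: indicator_def\<close>)
    then show "(\<lambda>n. LINT x|M. w n x) \<longlonglongrightarrow> 0" using box_lim by simp
  qed (use w_bound box_lim in \<open>auto simp: M_def\<close>)
  moreover have "(LINT x|M. w n x * h x) = (LINT x|lborel. indicator Q x * (w n x * h x))" for n
    using h by (intro M_int) (simp add: borel_measurable_integrable)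
  ultimately show ?thesis by (simp add: w_def)
qed

section \<open>Lebesgue measurability and essentially bounded functions\<close>

lemma Q_lebesgue [measurable, simp]: "(Q :: (real \<times> (real^'d)) set) \<in> sets lebesgue"
  using Q_borel by simp

lemma AE_lebesgue_on_iff:
  "S \<in> sets lebesgue \<Longrightarrow> (AE x in lebesgue_on S. P x) \<longleftrightarrow> (AE x in lborel. x \<in> S \<longrightarrow> P x)"
  by (simp add: AE_restrict_space_iff AE_completion_iff)

text \<open>Completeness of Lebesgue measure. Functions built from \<open>rho_n\<close> thereby
  inherit measurability from their formula off the interfaces.\<close>

lemma borel_measurable_lebesgue_on_AE:
  fixes f g :: "'a::euclidean_space \<Rightarrow> real"
  assumes S: "S \<in> sets lebesgue" and f: "f \<in> borel_measurable (lebesgue_on S)"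
    and ae: "AE x in lebesgue_on S. f x = g x"
  shows "g \<in> borel_measurable (lebesgue_on S)"
proof -
  have "(\<lambda>x. indicator S x *\<^sub>R f x) \<in> borel_measurable lebesgue"
    using f S by (simp add: borel_measurable_restrict_space_iff)
  moreover have "AE x in lebesgue. indicator S x *\<^sub>R f x = indicator S x *\<^sub>R g x"
    using ae S by (auto simp: AE_restrict_space_iff indicator_def elim: eventually_mono)
  ultimately have "(\<lambda>x. indicator S x *\<^sub>R g x) \<in> borel_measurable lebesgue"
    by (rule borel_measurable_AE)
  then show ?thesis using S by (simp add: borel_measurable_restrict_space_iff)
qed

lemma borel_measurable_lebesgue_onI:
  "f \<in> borel_measurable borel \<Longrightarrow> f \<in> borel_measurable (lebesgue_on S)"
  by (intro measurable_restrict_space1 measurable_completion) simp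

lemma LinfI:
  assumes "f \<in> borel_measurable (lebesgue_on S)"
    and "AE x in lebesgue_on S. norm (f x) \<le> C"
  shows "f \<in> Linf S" "Linf_norm S f \<le> ereal C"
proof -
  show "Linf_norm S f \<le> ereal C"
    unfolding Linf_norm_def using assms by (intro esssup_I) auto
  then show "f \<in> Linf S"
    using assms(1) by (auto simp: Linf_def)
qed

lemma AE_norm_le_Linf_norm: "AE x in lebesgue_on S. ereal (norm (f x)) \<le> Linf_norm S f"
  unfolding Linf_norm_def by (rule esssup_AE)

lemma Linf_boundedE:
  assumes "f \<in> Linf S"
  obtains C where "AE x in lebesgue_on S. norm (f x) \<le> C"
proof -
  have "Linf_norm S f < \<infinity>" using assms by (simp add: Linf_def)
  then obtain C :: real where "Linf_norm S f \<le> ereal C"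
    by (cases "Linf_norm S f") auto
  then have "AE x in lebesgue_on S. norm (f x) \<le> C"
    using AE_norm_le_Linf_norm[of f S]
    by (auto elim!: eventually_mono dest: order_trans)
  then show thesis by (rule that)
qed

lemma integrable_Linf_mult:
  fixes f h :: "'a::euclidean_space \<Rightarrow> real"
  assumes "f \<in> Linf S" "integrable (lebesgue_on S) h"
  shows "integrable (lebesgue_on S) (\<lambda>x. f x * h x)"
proof -
  obtain C where C: "AE x in lebesgue_on S. norm (f x) \<le> C"
    using assms(1) by (rule Linf_boundedE)
  show ?thesis
  proof (rule Bochner_Integration.integrable_bound)
    show "integrable (lebesgue_on S) (\<lambda>x. C * h x)" using assms(2) by simp
    show "(\<lambda>x. f x * h x) \<in> borel_measurable (lebesgue_on S)"
      using assms by (intro borel_measurable_times) (auto simp: Linf_def)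
    show "AE x in lebesgue_on S. norm (f x * h x) \<le> norm (C * h x)"
      using C by eventually_elim (auto simp: abs_mult intro: mult_right_mono)
  qed
qed

section \<open>The density off the interfaces and the limits of its compositions\<close>

lemma AE_not_on_cone:
  "AE x in lborel. norm (snd x :: real^'d) \<noteq> c * fst x"
proof -
  have "AE x in (lborel :: real measure) \<Otimes>\<^sub>M (lborel :: (real^'d) measure).
      norm (snd x) \<noteq> c * fst x"
  proof (rule lborel_pair.AE_pair_measure)
    show "AE t in lborel. AE y in (lborel :: (real^'d) measure).
        norm (snd (t, y)) \<noteq> c * fst (t, y)"
    proof (rule AE_I2)
      fix t :: real
      \<comment> \<open>At a fixed time the cone is a sphere, which is null; for a negative radius
        it is empty. Fubini then makes the cone itself null.\<close>
      have "sphere 0 (c * t) \<in> null_sets (lebesgue :: (real^'d) measure)"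
        using negligible_sphere negligible_iff_null_sets by blast
      then have "AE y in lebesgue. y \<notin> sphere (0::real^'d) (c * t)" by (rule AE_not_in)
      then show "AE y in (lborel :: (real^'d) measure). norm (snd (t, y)) \<noteq> c * fst (t, y)"
        by (simp add: AE_completion_iff)
    qed
  qed measurable
  then show ?thesis unfolding lborel_prod .
qed

text \<open>With s = n|y|/t the layer index is the floor of s and the phase is decided by
  \<open>frac s\<close>. The index stays below n because |y| < 1 \<le> t on Q, so the search over k
  in \<open>rho_n\<close> always succeeds off the interfaces.\<close>

lemma rho_n_eq:
  fixes y :: "real^'d"
  assumes theta: "0 < \<theta>" "\<theta> < 1" and n: "n \<ge> 1" and Q: "(t, y) \<in> Q"
    and off: "\<And>k::int. norm y \<noteq> (of_int k / real n) * t"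
      "\<And>k::int. norm y \<noteq> ((of_int k + \<theta>) / real n) * t"
  shows "rho_n \<theta> a b n (t, y)
    = (if frac (real n * norm y / t) < \<theta> then a else b) / t ^ CARD('d)"
proof -
  define s where "s = real n * norm y / t"
  have t: "1 \<le> t" "norm y < 1" using Q by (auto simp: Q_def)
  have "norm y < t" using t by simp
  then have s0: "0 \<le> s" "s < real n" using n t by (auto simp: s_def divide_less_eq)
  define k where "k = nat \<lfloor>s\<rfloor>"
  have k: "real k = of_int \<lfloor>s\<rfloor>" using s0 by (simp add: k_def)
  have ks: "real k \<le> s" "s < real k + 1" unfolding k by linarith+
  have kn: "k < n" using ks s0 by linarith
  have ns: "s \<noteq> of_int j" "s \<noteq> of_int j + \<theta>" for j
    using off[of j] n t by (auto simp: s_def field_simps)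
  have fr: "frac s = s - real k" by (simp add: frac_def k)
  have iff: "c / real n < norm y / t \<longleftrightarrow> c < s" "norm y / t < c / real n \<longleftrightarrow> s < c" for c
    using n t by (auto simp: s_def field_simps)
  have sk: "real k < s" using ks(1) ns(1)[of "int k"] by simp
  show ?thesis
  proof (cases "frac s < \<theta>")
    case True
    then have "\<exists>k<n. real k < s \<and> s < real k + \<theta>"
      using kn sk fr by (intro exI[of _ k]) auto
    then show ?thesis using True unfolding rho_n_def prod.case iff by (simp add: s_def)
  next
    case False
    \<comment> \<open>The first branch of \<open>rho_n\<close> has priority, so every other layer
      must be excluded as well: k' < s < k' + \<theta> forces k' to be the floor of s.\<close>
    have "\<not> (\<exists>k'<n. real k' < s \<and> s < real k' + \<theta>)"
    proof
      assume "\<exists>k'<n. real k' < s \<and> s < real k' + \<theta>"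
      then obtain k' where k': "real k' < s" "s < real k' + \<theta>" by blast
      then have "k' = k" using theta ks by linarith
      then show False using k' False fr by simp
    qed
    moreover have "\<exists>k<n. real k + \<theta> < s \<and> s < real k + 1"
      using kn ks fr False ns(2)[of "int k"] by (intro exI[of _ k]) auto
    ultimately show ?thesis using False unfolding rho_n_def prod.case iff
      by (simp only: if_False if_True simp_thms flip: s_def)
  qed
qed

lemma AE_rho_n:
  assumes "0 < \<theta>" "\<theta> < 1" "n \<ge> 1"
  shows "AE x in lborel. x \<in> Q \<longrightarrow> rho_n \<theta> a b n (x :: real \<times> (real^'d))
    = (if frac (real n * norm (snd x) / fst x) < \<theta> then a else b) / fst x ^ CARD('d)"
proof -
  have "AE x in lborel. \<forall>k::int. norm (snd x :: real^'d) \<noteq> (of_int k / real n) * fst x"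
    "AE x in lborel. \<forall>k::int. norm (snd x :: real^'d) \<noteq> ((of_int k + \<theta>) / real n) * fst x"
    unfolding AE_all_countable using AE_not_on_cone by blast+
  then show ?thesis
  proof eventually_elim
    case (elim x)
    show ?case
      using rho_n_eq[OF assms, of "fst x" "snd x" a b] elim by (simp del: times_divide_eq_left)
  qed
qed

text \<open>By \<open>split\<close>, f n is the proposed limit plus the square wave times \<alpha>1
  - \<alpha>2. Multiplying that difference into the test function leaves a weak limit of the wave
  alone.\<close>

lemma weak_star_two_phase:
  fixes \<alpha>1 \<alpha>2 :: "real \<times> (real^'d) \<Rightarrow> real"
  assumes theta: "0 < \<theta>" "\<theta> < 1"
    and \<alpha>: "\<alpha>1 \<in> borel_measurable (lebesgue_on Q)" "\<alpha>2 \<in> borel_measurable (lebesgue_on Q)"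
    and bound: "\<And>x. x \<in> Q \<Longrightarrow> \<bar>\<alpha>1 x\<bar> \<le> C" "\<And>x. x \<in> Q \<Longrightarrow> \<bar>\<alpha>2 x\<bar> \<le> C"
    and ae: "\<And>n. AE x in lebesgue_on Q.
      f n x = (if frac (real (Suc n) * norm (snd x) / fst x) < \<theta> then \<alpha>1 x else \<alpha>2 x)"
  shows "Linf_weak_star_lim Q f (\<lambda>x. \<theta> * \<alpha>1 x + (1 - \<theta>) * \<alpha>2 x)"
    and "Linf_norm Q (f n) \<le> ereal C"
proof -
  let ?w = "\<lambda>n (x :: real \<times> (real^'d)). square_wave \<theta> (real (Suc n) * norm (snd x) / fst x)"
  let ?g = "\<lambda>n (x :: real \<times> (real^'d)). if frac (real (Suc n) * norm (snd x) / fst x) < \<theta> then \<alpha>1 x else \<alpha>2 x"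
  let ?l = "\<lambda>x. \<theta> * \<alpha>1 x + (1 - \<theta>) * \<alpha>2 x"
  have split: "?g n x = ?l x + ?w n x * (\<alpha>1 x - \<alpha>2 x)" for n x
    by (simp add: square_wave_def algebra_simps)
  have w_borel [measurable]: "?w n \<in> borel_measurable borel" for n
    unfolding borel_prod[symmetric] by measurable
  have [measurable]: "?w n \<in> borel_measurable (lebesgue_on Q)" for n
    by (rule borel_measurable_lebesgue_onI[OF w_borel])
  note \<alpha> [measurable]
  have ae_Q: "AE x in lebesgue_on Q. (x :: real \<times> (real^'d)) \<in> Q"
    using AE_space[of "lebesgue_on Q"] by simp
  have f_meas [measurable]: "f n \<in> borel_measurable (lebesgue_on Q)" for n
  proof (rule borel_measurable_lebesgue_on_AE)
    show "?g n \<in> borel_measurable (lebesgue_on Q)" unfolding split by measurable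
    show "AE x in lebesgue_on Q. ?g n x = f n x" using ae[of n] by eventually_elim simp
  qed simp
  have f_bound: "AE x in lebesgue_on Q. norm (f n x) \<le> C" for n
    using ae[of n] ae_Q by eventually_elim (use bound in auto)
  show "Linf_norm Q (f n) \<le> ereal C" by (rule LinfI[OF f_meas f_bound])
  have f_Linf: "f n \<in> Linf Q" for n by (rule LinfI[OF f_meas f_bound])
  have C0: "0 \<le> C"
    using bound(1)[of "(1, 0)"] by (simp add: Q_def)
  have l_Linf: "?l \<in> Linf Q"
  proof (rule LinfI)
    show "AE x in lebesgue_on Q. norm (?l x) \<le> C"
      using ae_Q
    proof eventually_elim
      case (elim x)
      have "\<bar>?l x\<bar> \<le> \<theta> * \<bar>\<alpha>1 x\<bar> + (1 - \<theta>) * \<bar>\<alpha>2 x\<bar>"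
        using theta by (intro order_trans[OF abs_triangle_ineq]) (simp add: abs_mult)
      also have "\<dots> \<le> \<theta> * C + (1 - \<theta>) * C"
        using theta bound[OF elim] by (intro add_mono mult_left_mono) auto
      finally show ?case by (simp add: algebra_simps)
    qed
  qed measurable
  have d_Linf: "(\<lambda>x. \<alpha>1 x - \<alpha>2 x) \<in> Linf Q"
  proof (rule LinfI)
    show "AE x in lebesgue_on Q. norm (\<alpha>1 x - \<alpha>2 x) \<le> C + C"
      using ae_Q
    proof eventually_elim
      case (elim x)
      then show ?case
        using order_trans[OF abs_triangle_ineq4 add_mono[OF bound]] by simp
    qed
  qed measurable
  have w_Linf: "?w n \<in> Linf Q" for n
  proof (rule LinfI)
    show "AE x in lebesgue_on Q. norm (?w n x) \<le> 1"
      using abs_square_wave_le[OF theta] by (intro AE_I2) (simp only: real_norm_def)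
  qed measurable
  have "(\<lambda>n. LINT x|lebesgue_on Q. f n x * h x) \<longlonglongrightarrow> (LINT x|lebesgue_on Q. ?l x * h x)"
    if h: "integrable (lebesgue_on Q) h" for h
  proof -
    define g where "g x = (\<alpha>1 x - \<alpha>2 x) * h x" for x
    have g: "integrable (lebesgue_on Q) g"
      unfolding g_def by (rule integrable_Linf_mult[OF d_Linf h])
    have g_leb: "integrable lebesgue (\<lambda>x. indicator Q x * g x)"
      using g by (simp add: integrable_restrict_space)
    \<comment> \<open>The limit of the wave is known for functions integrable over
      \<open>lborel\<close>, whereas g is only Lebesgue measurable; a Borel function equal to it
      almost everywhere takes its place.\<close>
    then obtain g' where g' [measurable]: "g' \<in> borel_measurable lborel"
      and g'_ae: "AE x in lborel. indicator Q x * g x = g' x"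
      using completion_ex_borel_measurable_real[of "\<lambda>x. indicator Q x * g x" lborel]
      by auto
    have "integrable lebesgue g'"
      using g'_ae g_leb
      by (subst integrable_cong_AE[of _ _ "\<lambda>x. indicator Q x * g x"])
         (auto simp: AE_completion_iff measurable_completion borel_measurable_integrable elim: eventually_mono)
    then have g'_int: "integrable lborel g'"
      by (simp add: integrable_completion)
    have "(LINT x|lebesgue_on Q. ?w n x * g x)
        = (LINT x|lborel. indicator Q x * (?w n x * g' x))" for n
    proof -
      have "(LINT x|lebesgue_on Q. ?w n x * g x)
          = (LINT x|lebesgue. ?w n x * (indicator Q x * g x))"
        by (simp add: integral_restrict_space mult_ac)
      also have "\<dots> = (LINT x|lebesgue. indicator Q x * (?w n x * g' x))"
      proof (rule integral_cong_AE)
        show "AE x in lebesgue. ?w n x * (indicator Q x * g x) = indicator Q x * (?w n x * g' x)"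
          unfolding AE_completion_iff using g'_ae
          by eventually_elim (auto split: split_indicator_asm)
        show "(\<lambda>x. ?w n x * (indicator Q x * g x)) \<in> borel_measurable lebesgue"
          by (rule borel_measurable_times[OF _ borel_measurable_integrable[OF g_leb]])
             (rule measurable_completion, measurable)
        show "(\<lambda>x. indicator Q x * (?w n x * g' x)) \<in> borel_measurable lebesgue"
          by (rule measurable_completion) measurable
      qed
      also have "\<dots> = (LINT x|lborel. indicator Q x * (?w n x * g' x))"
        by (rule integral_completion) measurable
      finally show ?thesis .
    qed
    then have null: "(\<lambda>n. LINT x|lebesgue_on Q. ?w n x * g x) \<longlonglongrightarrow> 0"
      using square_wave_weak_null[OF theta g'_int] by simp
    have "(LINT x|lebesgue_on Q. f n x * h x)
        = (LINT x|lebesgue_on Q. ?l x * h x) + (LINT x|lebesgue_on Q. ?w n x * g x)" for n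
    proof -
      have "(LINT x|lebesgue_on Q. f n x * h x)
          = (LINT x|lebesgue_on Q. ?l x * h x + ?w n x * g x)"
      proof (rule integral_cong_AE)
        show "AE x in lebesgue_on Q. f n x * h x = ?l x * h x + ?w n x * g x"
          using ae[of n]
        proof eventually_elim
          case (elim x)
          show ?case unfolding elim split g_def by (simp only: distrib_right mult.assoc)
        qed
      qed (use borel_measurable_integrable[OF h, measurable]
          borel_measurable_integrable[OF g, measurable] in measurable)
      also have "\<dots> = (LINT x|lebesgue_on Q. ?l x * h x) + (LINT x|lebesgue_on Q. ?w n x * g x)"
        by (intro Bochner_Integration.integral_add integrable_Linf_mult l_Linf w_Linf h g)
      finally show ?thesis .
    qed
    then show ?thesis using tendsto_add[OF tendsto_const null] by simp
  qed
  then show "Linf_weak_star_lim Q f ?l"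
    using f_Linf l_Linf by (simp add: Linf_weak_star_lim_def)
qed

text \<open>For t in [1, 2] the density c/t^d moves continuously within (0, \<infinity>), so the
  composition is continuous on a compact interval. This is how functions continuous only on positive
  densities, such as the pressure, are handled.\<close>

lemma bounded_pressure_profile:
  fixes \<beta> :: "real \<Rightarrow> real"
  assumes "continuous_on {0<..} \<beta>" "0 < c"
  obtains C where "\<And>t. t \<in> {1..2} \<Longrightarrow> \<bar>\<beta> (c / t ^ d)\<bar> \<le> C"
    and "continuous_on {1..2} (\<lambda>t. \<beta> (c / t ^ d))"
proof -
  have cont: "continuous_on {1..2} (\<lambda>t. \<beta> (c / t ^ d))"
    using assms(2) by (intro continuous_on_compose2[OF assms(1)] continuous_intros) auto
  have "compact ((\<lambda>t. \<beta> (c / t ^ d)) ` {1..2})"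
    by (intro compact_continuous_image cont compact_Icc)
  then obtain C where "\<forall>x\<in>(\<lambda>t. \<beta> (c / t ^ d)) ` {1..2}. norm x \<le> C"
    using compact_imp_bounded bounded_iff by blast
  then show thesis using cont by (intro that[of C]) auto
qed

lemma borel_measurable_on_Q:
  fixes f :: "real \<Rightarrow> real"
  assumes "continuous_on {1..2} f"
  shows "(\<lambda>x :: real \<times> (real^'d). f (fst x)) \<in> borel_measurable (lebesgue_on Q)"
proof (rule continuous_imp_measurable_on_sets_lebesgue)
  show "continuous_on Q (\<lambda>x :: real \<times> (real^'d). f (fst x))"
    by (rule continuous_on_compose2[OF assms continuous_on_fst[OF continuous_on_id]])
       (auto simp: Q_def)
qed simp

text \<open>One statement with three uses: the identity gives the limit of the densities, p gives
  the limit of the pressures, and a general \<beta> gives the Young measure. The shift to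
  \<open>Suc n\<close> omits n = 0, for which there are no layers.\<close>

lemma weak_star_rho_n:
  fixes \<beta> :: "real \<Rightarrow> real"
  assumes theta: "0 < \<theta>" "\<theta> < 1" and ab: "0 < a" "0 < b"
    and \<beta>: "continuous_on {0<..} \<beta>"
  shows "Linf_weak_star_lim (Q :: (real \<times> (real^'d)) set) (\<lambda>n x. \<beta> (rho_n \<theta> a b (Suc n) x))
    (\<lambda>x. \<theta> * \<beta> (a / fst x ^ CARD('d)) + (1 - \<theta>) * \<beta> (b / fst x ^ CARD('d)))"
    and "\<exists>C. \<forall>n. Linf_norm (Q :: (real \<times> (real^'d)) set)
      (\<lambda>x. \<beta> (rho_n \<theta> a b (Suc n) x)) \<le> ereal C"
proof -
  let ?\<alpha> = "\<lambda>c (x :: real \<times> (real^'d)). \<beta> (c / fst x ^ CARD('d))"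
  obtain C1 where C1: "\<And>t. t \<in> {1..2} \<Longrightarrow> \<bar>\<beta> (a / t ^ CARD('d))\<bar> \<le> C1"
    and cont1: "continuous_on {1..2} (\<lambda>t. \<beta> (a / t ^ CARD('d)))"
    using bounded_pressure_profile[OF \<beta> ab(1)] by blast
  obtain C2 where C2: "\<And>t. t \<in> {1..2} \<Longrightarrow> \<bar>\<beta> (b / t ^ CARD('d))\<bar> \<le> C2"
    and cont2: "continuous_on {1..2} (\<lambda>t. \<beta> (b / t ^ CARD('d)))"
    using bounded_pressure_profile[OF \<beta> ab(2)] by blast
  have meas: "?\<alpha> a \<in> borel_measurable (lebesgue_on Q)" "?\<alpha> b \<in> borel_measurable (lebesgue_on Q)"
    by (rule borel_measurable_on_Q[OF cont1] borel_measurable_on_Q[OF cont2])+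
  have bnd: "\<bar>?\<alpha> a x\<bar> \<le> max C1 C2" "\<bar>?\<alpha> b x\<bar> \<le> max C1 C2" if "x \<in> Q" for x
    using that C1[of "fst x"] C2[of "fst x"] by (auto simp: Q_def le_max_iff_disj)
  have ae: "AE x in lebesgue_on (Q :: (real \<times> (real^'d)) set). \<beta> (rho_n \<theta> a b (Suc n) x)
      = (if frac (real (Suc n) * norm (snd x) / fst x) < \<theta> then ?\<alpha> a x else ?\<alpha> b x)" for n
    unfolding AE_lebesgue_on_iff[OF Q_lebesgue]
    using AE_rho_n[OF theta, of "Suc n" a b] by (auto elim!: eventually_mono)
  note * = weak_star_two_phase[OF theta meas bnd ae]
  show "Linf_weak_star_lim (Q :: (real \<times> (real^'d)) set) (\<lambda>n x. \<beta> (rho_n \<theta> a b (Suc n) x))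
      (\<lambda>x. \<theta> * ?\<alpha> a x + (1 - \<theta>) * ?\<alpha> b x)"
    by (rule *(1))
  show "\<exists>C. \<forall>n. Linf_norm (Q :: (real \<times> (real^'d)) set)
      (\<lambda>x. \<beta> (rho_n \<theta> a b (Suc n) x)) \<le> ereal C"
    using *(2) by blast
qed

text \<open>On a null space the essential supremum of 0 would be -\<infinity>, and every statement
  would hold almost everywhere. Positivity of the measure is thus what makes the strong limit have
  norm 0 and the failure q \<noteq> p(\<rho>) genuine.\<close>

lemma emeasure_lebesgue_on_Q:
  "emeasure (lebesgue_on (Q :: (real \<times> (real^'d)) set)) (space (lebesgue_on Q)) \<noteq> 0"
proof -
  have "emeasure lborel (Q :: (real \<times> (real^'d)) set)
      = emeasure lborel {1..2::real} * emeasure lborel (ball (0::real^'d) 1)"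
    unfolding Q_def lborel_prod[symmetric]
    by (rule lborel.emeasure_pair_measure_Times) auto
  also have "\<dots> \<noteq> 0"
    using content_ball_pos[of 1 "0 :: real^'d"] by (auto simp: measure_def)
  finally show ?thesis by (simp add: emeasure_restrict_space)
qed

lemma integrable_Linf:
  fixes f :: "real \<times> (real^'d) \<Rightarrow> real"
  assumes "f \<in> Linf Q"
  shows "integrable (lebesgue_on Q) f"
proof -
  have "integrable lborel (indicator (Q :: (real \<times> (real^'d)) set) :: _ \<Rightarrow> real)"
    by (intro integrable_bounded_support[OF _ bounded_Q, where B=1]) (auto split: split_indicator)
  then have "integrable (lebesgue_on Q) (\<lambda>x :: real \<times> (real^'d). 1 :: real)"
    by (simp add: integrable_restrict_space integrable_completion)
  from integrable_Linf_mult[OF assms this] show ?thesis by simp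
qed

text \<open>Q has finite measure, so the difference of the two limits is itself an admissible test
  function; testing with it makes the integral of its square vanish.\<close>

lemma Linf_weak_star_lim_unique:
  fixes g g' :: "real \<times> (real^'d) \<Rightarrow> real"
  assumes "Linf_weak_star_lim Q f g" "Linf_weak_star_lim Q f g'"
  shows "AE x in lebesgue_on Q. g x = g' x"
proof -
  let ?h = "\<lambda>x. g x - g' x"
  have L: "g \<in> Linf Q" "g' \<in> Linf Q" using assms by (auto simp: Linf_weak_star_lim_def)
  have h: "integrable (lebesgue_on Q) ?h" using L by (auto intro: integrable_Linf)
  have "(LINT x|lebesgue_on Q. g x * ?h x) = (LINT x|lebesgue_on Q. g' x * ?h x)"
    using assms h unfolding Linf_weak_star_lim_def by (meson LIMSEQ_unique)
  moreover have gh: "integrable (lebesgue_on Q) (\<lambda>x. g x * ?h x)"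
    "integrable (lebesgue_on Q) (\<lambda>x. g' x * ?h x)"
    using L h by (auto intro: integrable_Linf_mult)
  moreover have "g x * ?h x - g' x * ?h x = ?h x * ?h x" for x by (simp add: algebra_simps)
  ultimately have "(LINT x|lebesgue_on Q. ?h x * ?h x) = 0"
    and "integrable (lebesgue_on Q) (\<lambda>x. ?h x * ?h x)"
    using Bochner_Integration.integral_diff[OF gh] Bochner_Integration.integrable_diff[OF gh]
    by simp_all
  then have "AE x in lebesgue_on Q. ?h x * ?h x = 0"
    by (subst (asm) integral_nonneg_eq_0_iff_AE) auto
  then show ?thesis by eventually_elim simp
qed

section \<open>Young measure\<close>

text \<open>\<open>measure_of\<close> takes the prescribed values only if these are countably
  additive. Recognising the mixture as the image of a Bernoulli law settles this and turns integrals
  into two-point sums.\<close>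

lemma dirac_mix_eq_distr:
  assumes "0 < \<theta>" "\<theta> < 1"
  shows "dirac_mix \<theta> r s = distr (measure_pmf (bernoulli_pmf \<theta>)) borel (\<lambda>c. if c then r else s)"
    (is "_ = ?N")
proof -
  have "emeasure ?N A
      = ennreal \<theta> * emeasure (return borel r) A + ennreal (1 - \<theta>) * emeasure (return borel s) A"
    if A [measurable]: "A \<in> sets borel" for A
  proof -
    have "emeasure ?N A = (\<integral>\<^sup>+x. indicator A x \<partial>?N)" by simp
    also have "\<dots> = (\<integral>\<^sup>+c. indicator A (if c then r else s) \<partial>measure_pmf (bernoulli_pmf \<theta>))"
      by (subst nn_integral_distr) auto
    also have "\<dots> = indicator A r * ennreal \<theta> + indicator A s * ennreal (1 - \<theta>)"
      using assms by (subst nn_integral_bernoulli_pmf) auto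
    finally show ?thesis using A by (simp add: mult.commute)
  qed
  then have "dirac_mix \<theta> r s = measure_of UNIV (sets borel) (emeasure ?N)"
    unfolding dirac_mix_def by (intro measure_of_eq) (auto simp: sets.sigma_sets_eq[of borel, simplified])
  also have "\<dots> = ?N" using measure_of_of_measure[of ?N] by simp
  finally show ?thesis .
qed

lemma dirac_mix:
  fixes \<beta> :: "real \<Rightarrow> real"
  assumes theta: "0 < \<theta>" "\<theta> < 1"
  shows "prob_space (dirac_mix \<theta> r s)" and "sets (dirac_mix \<theta> r s) = sets borel"
    and "\<beta> \<in> borel_measurable borel \<Longrightarrow> integrable (dirac_mix \<theta> r s) \<beta>"
    and "\<beta> \<in> borel_measurable borel \<Longrightarrow>
      (LINT x|dirac_mix \<theta> r s. \<beta> x) = \<theta> * \<beta> r + (1 - \<theta>) * \<beta> s"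
proof -
  note eq = dirac_mix_eq_distr[OF theta]
  show "prob_space (dirac_mix \<theta> r s)" unfolding eq by (rule measure_pmf.prob_space_distr) simp
  show "sets (dirac_mix \<theta> r s) = sets borel" unfolding eq by simp
  assume [measurable]: "\<beta> \<in> borel_measurable borel"
  show "integrable (dirac_mix \<theta> r s) \<beta>"
    unfolding eq by (subst integrable_distr_eq) (auto intro: integrable_measure_pmf_finite)
  show "(LINT x|dirac_mix \<theta> r s. \<beta> x) = \<theta> * \<beta> r + (1 - \<theta>) * \<beta> s"
    unfolding eq using theta by (subst integral_distr) (auto simp: mult.commute)
qed

text \<open>For q < q' a continuous cutoff: 1 up to q, 0 from q' on, affine between. It stands in
  for the indicator of a half-line, which is not a legitimate \<beta>.\<close>

definition ramp :: "real \<Rightarrow> real \<Rightarrow> real \<Rightarrow> real" where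
  "ramp q q' s = max 0 (min 1 ((q' - s) / (q' - q)))"

lemma continuous_ramp: "continuous_on UNIV (ramp q q')"
\<comment> \<open>For q = q' division by zero makes the ramp identically 0, hence still
  continuous.\<close>
proof (cases "q = q'")
  case False
  then show ?thesis unfolding ramp_def by (intro continuous_intros) auto
qed (simp add: ramp_def[abs_def])

text \<open>Ramps shrinking to a half-line recover the distribution function, which determines the
  law. Rational parameters keep the family countable, as is needed to merge null sets.\<close>

lemma measure_eqI_ramp:
  assumes "prob_space M" "sets M = sets borel" "prob_space N" "sets N = sets borel"
    and eq: "\<And>q q'. q \<in> \<rat> \<Longrightarrow> q' \<in> \<rat> \<Longrightarrow> q < q' \<Longrightarrow>
      (LINT s|M. ramp q q' s) = (LINT s|N. ramp q q' s)"
  shows "M = N"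
proof (rule cdf_unique)
  show M: "real_distribution M"
    using assms by (simp add: real_distribution_def real_distribution_axioms_def)
  show N: "real_distribution N"
    using assms by (simp add: real_distribution_def real_distribution_axioms_def)
  show "cdf M = cdf N"
  proof
    fix x :: real
    \<comment> \<open>Both parameters approach x strictly from the right, so the ramps equal 1 at x
      itself and the limit is the indicator of the closed half-line.\<close>
    have "\<exists>q q'. q \<in> \<rat> \<and> q' \<in> \<rat> \<and> x < q \<and> q < q' \<and> q' < x + 1 / real (Suc m)" for m
    proof -
      have "x < x + 1 / real (Suc m)" by simp
      then obtain q where q: "q \<in> \<rat>" "x < q" "q < x + 1 / real (Suc m)"
        using Rats_dense_in_real by blast
      then show ?thesis using Rats_dense_in_real by blast
    qed
    then obtain q q' where q: "\<And>m. q m \<in> \<rat>" "\<And>m. q' m \<in> \<rat>" "\<And>m. x < q m"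
      "\<And>m. q m < q' m" "\<And>m. q' m < x + 1 / real (Suc m)"
      by metis
    have lim: "(\<lambda>m. ramp (q m) (q' m) s) \<longlonglongrightarrow> indicator {..x} s" for s
    proof (cases "s \<le> x")
      case True
      have "ramp (q m) (q' m) s = 1" for m
      proof -
        have "1 \<le> (q' m - s) / (q' m - q m)" using True q(3)[of m] q(4)[of m] by simp
        then show ?thesis by (simp add: ramp_def)
      qed
      then show ?thesis using True by simp
    next
      case False
      then obtain K where K: "1 / real (Suc K) < s - x"
        using nat_approx_posE[of "s - x"] by auto
      have "ramp (q m) (q' m) s = 0" if "K \<le> m" for m
      proof -
        have "1 / real (Suc m) \<le> 1 / real (Suc K)" using that by (intro divide_left_mono) auto
        then have "q' m - s \<le> 0" using q(5)[of m] K by linarith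
        then have "(q' m - s) / (q' m - q m) \<le> 0" using q(4)[of m] by (simp add: divide_le_0_iff)
        then show ?thesis by (simp add: ramp_def)
      qed
      then have "\<forall>\<^sub>F m in sequentially. ramp (q m) (q' m) s = 0"
        by (auto simp: eventually_sequentially)
      then show ?thesis using False by (simp add: tendsto_eventually)
    qed
    have conv: "(\<lambda>m. LINT s|L. ramp (q m) (q' m) s) \<longlonglongrightarrow> cdf L x" if "real_distribution L" for L
    proof -
      interpret L: real_distribution L by fact
      have "(\<lambda>m. LINT s|L. ramp (q m) (q' m) s) \<longlonglongrightarrow> (LINT s|L. indicator {..x} s)"
      proof (rule integral_dominated_convergence)
        show "integrable L (\<lambda>s. 1 :: real)" by simp
        show "AE s in L. norm (ramp (q m) (q' m) s) \<le> 1" for m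
          by (intro AE_I2) (simp add: ramp_def)
        show "ramp (q m) (q' m) \<in> borel_measurable L" for m
          using borel_measurable_continuous_onI[OF continuous_ramp] by simp
      qed (use lim in auto)
      then show ?thesis by (simp add: cdf_def)
    qed
    show "cdf M x = cdf N x"
      using conv[OF M] conv[OF N] eq[OF q(1,2,4)] LIMSEQ_unique by simp
  qed
qed

text \<open>For each ramp the two integrals agree off a null set by uniqueness of weak-star limits.
  Over rational parameters these null sets have a null union, off which the two measures
  coincide.\<close>

lemma young_measure_unique:
  fixes \<nu> \<nu>' :: "real \<times> (real^'d) \<Rightarrow> real measure"
  assumes "is_young_measure Q f \<nu>" "is_young_measure Q f \<nu>'"
  shows "AE x in lebesgue_on Q. \<nu> x = \<nu>' x"
proof -
  have "AE x in lebesgue_on Q. (LINT s|\<nu> x. ramp q q' s) = (LINT s|\<nu>' x. ramp q q' s)" for q q'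
  proof (rule Linf_weak_star_lim_unique)
    show "Linf_weak_star_lim Q (\<lambda>n x. ramp q q' (f n x)) (\<lambda>x. LINT s|\<nu> x. ramp q q' s)"
      "Linf_weak_star_lim Q (\<lambda>n x. ramp q q' (f n x)) (\<lambda>x. LINT s|\<nu>' x. ramp q q' s)"
      using assms continuous_ramp unfolding is_young_measure_def by simp_all
  qed
  then have "AE x in lebesgue_on Q. \<forall>q\<in>\<rat>. \<forall>q'\<in>\<rat>.
      (LINT s|\<nu> x. ramp q q' s) = (LINT s|\<nu>' x. ramp q q' s)"
    by (simp add: AE_ball_countable countable_rat)
  moreover have "AE x in lebesgue_on Q. prob_space (\<nu> x) \<and> sets (\<nu> x) = sets borel"
    "AE x in lebesgue_on Q. prob_space (\<nu>' x) \<and> sets (\<nu>' x) = sets borel"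
    using assms by (auto simp: is_young_measure_def)
  ultimately show ?thesis
    by eventually_elim (auto intro: measure_eqI_ramp)
qed

lemma young_measure_rho_n:
  assumes theta: "0 < \<theta>" "\<theta> < 1" and ab: "0 < a" "0 < b"
  shows "is_young_measure (Q :: (real \<times> (real^'d)) set) (\<lambda>n. rho_n \<theta> a b (Suc n)) (nu_lim \<theta> a b)"
  unfolding is_young_measure_def
proof (intro conjI allI impI)
  show "\<exists>C. \<forall>n. Linf_norm (Q :: (real \<times> (real^'d)) set) (rho_n \<theta> a b (Suc n)) \<le> ereal C"
    using weak_star_rho_n(2)[OF theta ab continuous_on_id] by simp
  show "AE x in lebesgue_on (Q :: (real \<times> (real^'d)) set).
      prob_space (nu_lim \<theta> a b x) \<and> sets (nu_lim \<theta> a b x) = sets borel"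
    by (intro AE_I2) (simp add: nu_lim_def case_prod_beta' dirac_mix[OF theta])
  fix \<beta> :: "real \<Rightarrow> real" assume \<beta>: "continuous_on UNIV \<beta>"
  note m = borel_measurable_continuous_onI[OF \<beta>]
  show "AE x in lebesgue_on (Q :: (real \<times> (real^'d)) set). integrable (nu_lim \<theta> a b x) \<beta>"
    by (intro AE_I2) (simp add: nu_lim_def case_prod_beta' dirac_mix[OF theta] m)
  have "(\<lambda>x :: real \<times> (real^'d). LINT s|nu_lim \<theta> a b x. \<beta> s)
      = (\<lambda>x. \<theta> * \<beta> (a / fst x ^ CARD('d)) + (1 - \<theta>) * \<beta> (b / fst x ^ CARD('d)))"
    by (simp add: nu_lim_def case_prod_beta' dirac_mix[OF theta] m)
  then show "Linf_weak_star_lim (Q :: (real \<times> (real^'d)) set)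
      (\<lambda>n x. \<beta> (rho_n \<theta> a b (Suc n) x)) (\<lambda>x. LINT s|nu_lim \<theta> a b x. \<beta> s)"
    using weak_star_rho_n(1)[OF theta ab continuous_on_subset[OF \<beta> subset_UNIV]] by simp
qed

section \<open>The velocity limit and a pressure that does not commute with the weak limit\<close>

lemma u_n_strong_lim:
  "Linf_strong_lim (Q :: (real \<times> (real^'d)) set) (\<lambda>n. u_n (Suc n)) u_lim"
proof -
  have eq: "u_n n = u_lim" for n :: nat by (simp add: u_n_def u_lim_def)
  have "u_lim \<in> Linf (Q :: (real \<times> (real^'d)) set)"
  proof (rule LinfI)
    have "continuous_on Q (\<lambda>x :: real \<times> (real^'d). snd x /\<^sub>R fst x)"
      by (intro continuous_intros) (auto simp: Q_def)
    then show "u_lim \<in> borel_measurable (lebesgue_on (Q :: (real \<times> (real^'d)) set))"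
      unfolding u_lim_def case_prod_beta' by (rule continuous_imp_measurable_on_sets_lebesgue) simp
    show "AE x in lebesgue_on (Q :: (real \<times> (real^'d)) set). norm (u_lim x) \<le> 1"
      by (intro AE_I2) (auto simp: u_lim_def Q_def divide_le_eq field_simps)
  qed
  moreover have "Linf_norm (Q :: (real \<times> (real^'d)) set) (\<lambda>x. 0 :: real^'d) = 0"
    unfolding Linf_norm_def using esssup_const[OF emeasure_lebesgue_on_Q] by (simp add: zero_ereal_def)
  ultimately show ?thesis by (simp add: Linf_strong_lim_def eq)
qed

text \<open>A pressure that vanishes on the values of both phases but not between them.\<close>

lemma pressure_not_preserved:
  "\<exists>\<theta> a b p q. admissible CARD('d) \<theta> a b p \<and>
    Linf_weak_star_lim (Q :: (real \<times> (real^'d)) set) (\<lambda>n x. p (rho_n \<theta> a b (Suc n) x)) q \<and>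
    \<not> (AE x in lebesgue_on Q. q x = p (rho_lim \<theta> a b x))"
proof -
  \<comment> \<open>With a = 1 the light phase 1/t^d stays at or below 1 and the heavy phase b/t^d
    at or above B, while p is positive exactly on (1, B). The choice of \<theta> gives (1 -
    \<theta>) b = 2^d = B/2, so the mean density is (\<theta> + B/2)/t^d. As 1 \<le> t^d \<le> B/2,
    it lies strictly between 1 and B at every time.\<close>
  define B :: real where "B = 2 * 2 ^ CARD('d)"
  define \<theta> where "\<theta> = 1 - 1 / B"
  define b where "b = B * 2 ^ CARD('d)"
  define p where "p s = max 0 ((s - 1) * (B - s))" for s
  have B: "B \<ge> 2" "(1::real) < 2 ^ CARD('d)" "2 ^ CARD('d) = B / 2"
    using one_le_power[of "2::real" "CARD('d)"] by (auto simp: B_def one_less_power)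
  have theta: "0 < \<theta>" "\<theta> < 1" using B by (auto simp: \<theta>_def)
  have b: "0 < b" "1 < b / 2 ^ CARD('d)" "b / 2 ^ CARD('d) < b"
    using B by (auto simp: b_def)
  have pow: "1 \<le> t ^ CARD('d)" "t ^ CARD('d) \<le> B / 2" if "t \<in> {1..2}" for t :: real
    using that power_mono[of t 2 "CARD('d)"] B by auto
  have p1: "p (1 / t ^ CARD('d)) = 0" if "t \<in> {1..2}" for t :: real
  proof -
    have "1 / t ^ CARD('d) \<le> 1" using pow[OF that] by simp
    then have "(1 / t ^ CARD('d) - 1) * (B - 1 / t ^ CARD('d)) \<le> 0"
      using B by (intro mult_nonpos_nonneg) auto
    then show ?thesis by (simp add: p_def)
  qed
  have pb: "p (b / t ^ CARD('d)) = 0" if "t \<in> {1..2}" for t :: real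
  proof -
    have "B \<le> b / t ^ CARD('d)"
      using pow[OF that] B by (simp add: b_def le_divide_eq mult_left_mono)
    then have "(b / t ^ CARD('d) - 1) * (B - b / t ^ CARD('d)) \<le> 0"
      using B by (intro mult_nonneg_nonpos) auto
    then show ?thesis by (simp add: p_def)
  qed
  have p_cont: "continuous_on A p" for A unfolding p_def[abs_def] by (intro continuous_intros)
  have adm: "admissible CARD('d) \<theta> 1 b p"
    unfolding admissible_def using theta b B(2) p_cont p1 pb by auto
  let ?q = "\<lambda>x :: real \<times> (real^'d).
    \<theta> * p (1 / fst x ^ CARD('d)) + (1 - \<theta>) * p (b / fst x ^ CARD('d))"
  have lim: "Linf_weak_star_lim (Q :: (real \<times> (real^'d)) set)
      (\<lambda>n x. p (rho_n \<theta> 1 b (Suc n) x)) ?q"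
    by (rule weak_star_rho_n(1)[OF theta zero_less_one b(1) p_cont])
  have neq: "?q x \<noteq> p (rho_lim \<theta> 1 b x)" if "x \<in> Q" for x :: "real \<times> (real^'d)"
  proof -
    define T where "T = fst x ^ CARD('d)"
    have t: "fst x \<in> {1..2}" using that by (auto simp: Q_def)
    have T: "1 \<le> T" "T \<le> B / 2" using pow[OF t] by (auto simp: T_def)
    have r: "rho_lim \<theta> 1 b x = (\<theta> + B / 2) / T"
    proof -
      have "(1 - \<theta>) * b = B / 2" using B by (simp add: \<theta>_def b_def)
      moreover have "rho_lim \<theta> 1 b x = (\<theta> + (1 - \<theta>) * b) / T"
        by (simp add: rho_lim_def case_prod_beta' T_def add_divide_distrib)
      ultimately show ?thesis by simp
    qed
    have "1 < (\<theta> + B / 2) / T" using T theta by (simp add: less_divide_eq)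
    moreover have "(\<theta> + B / 2) / T \<le> (\<theta> + B / 2) / 1"
      using T theta B by (intro divide_left_mono) auto
    then have "(\<theta> + B / 2) / T < B" using theta B by simp
    ultimately have "0 < p (rho_lim \<theta> 1 b x)" unfolding r p_def by simp
    then show ?thesis using p1[OF t] pb[OF t] by simp
  qed
  have "\<not> (AE x in lebesgue_on (Q :: (real \<times> (real^'d)) set). ?q x = p (rho_lim \<theta> 1 b x))"
  proof
    assume "AE x in lebesgue_on (Q :: (real \<times> (real^'d)) set). ?q x = p (rho_lim \<theta> 1 b x)"
    then have "AE x in lebesgue_on (Q :: (real \<times> (real^'d)) set). False"
      using AE_space by eventually_elim (use neq in auto)
    then show False
      using emeasure_lebesgue_on_Q[where 'd='d] by (simp add: eventually_False ae_filter_eq_bot_iff)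
  qed
  with adm lim show ?thesis by blast
qed

section \<open>Weak solutions\<close>

lemma frechet_derivative_eq_dir_deriv: "frechet_derivative \<phi> (at x) = (\<lambda>v. dir_deriv v \<phi> x)"
  by (simp add: dir_deriv_def)

section \<open>Test functions and their derivatives\<close>

context
  fixes S :: "'a::euclidean_space set" and \<phi> :: "'a \<Rightarrow> real"
  assumes test: "\<phi> \<in> test_functions S"
begin

lemma test_function_differentiable: "\<phi> differentiable (at x)"
proof -
  have "Ck (Suc 0) \<phi>" using test by (simp add: test_functions_def del: Ck.simps)
  then show ?thesis by simp
qed

lemma test_function_has_derivative: "(\<phi> has_derivative (\<lambda>v. dir_deriv v \<phi> x)) (at x)"
  using test_function_differentiable[of x]
  by (simp add: frechet_derivative_works frechet_derivative_eq_dir_deriv)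

lemma test_function_continuous: "continuous_on UNIV \<phi>"
  using test_function_has_derivative has_derivative_continuous
  by (blast intro: continuous_at_imp_continuous_on)

lemma test_function_eq_0: "x \<notin> S \<Longrightarrow> \<phi> x = 0"
  using test closure_subset[of "{x. \<phi> x \<noteq> 0}"] by (auto simp: test_functions_def)

lemma test_function_bounded: obtains B where "\<And>x. \<bar>\<phi> x\<bar> \<le> B" "0 \<le> B"
proof -
  let ?K = "closure {x. \<phi> x \<noteq> 0}"
  have "compact (\<phi> ` ?K)"
    using test test_function_continuous
    by (intro compact_continuous_image) (auto simp: test_functions_def intro: continuous_on_subset)
  from compact_imp_bounded[OF this] obtain B where B: "\<forall>y\<in>\<phi> ` ?K. norm y \<le> B"
    unfolding bounded_iff by blast
  have "\<bar>\<phi> x\<bar> \<le> max 0 B" for x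
  proof (cases "\<phi> x = 0")
    case False
    then have "x \<in> ?K" using closure_subset[of "{x. \<phi> x \<noteq> 0}"] by auto
    then have "norm (\<phi> x) \<le> B" using B by blast
    then show ?thesis by simp
  qed simp
  then show thesis by (rule that) simp
qed

text \<open>Off its closed support \<phi> vanishes on a neighbourhood, so differentiation cannot
  enlarge the support. This allows the distributional derivatives in the stress term to be
  iterated.\<close>

lemma test_function_dir_deriv: "dir_deriv v \<phi> \<in> test_functions S"
proof -
  let ?K = "closure {x. \<phi> x \<noteq> 0}"
  have "Ck k (dir_deriv v \<phi>)" for k
  proof -
    have "Ck (Suc k) \<phi>" using test by (simp add: test_functions_def del: Ck.simps)
    then show ?thesis by simp
  qed
  moreover have "dir_deriv v \<phi> x = 0" if "x \<notin> ?K" for x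
  proof -
    have "((\<lambda>x. 0) has_derivative (\<lambda>v. 0)) (at x)" by simp
    then have "(\<phi> has_derivative (\<lambda>v. 0)) (at x)"
      by (rule has_derivative_transform_within_open[of _ _ _ _ "- ?K"])
         (use that closure_subset[of "{x. \<phi> x \<noteq> 0}"] in auto)
    from has_derivative_unique[OF test_function_has_derivative this] show ?thesis by meson
  qed
  then have "{x. dir_deriv v \<phi> x \<noteq> 0} \<subseteq> ?K" by blast
  then have sub: "closure {x. dir_deriv v \<phi> x \<noteq> 0} \<subseteq> ?K" by (simp add: closure_minimal)
  moreover have "compact ?K" "?K \<subseteq> S" using test by (auto simp: test_functions_def)
  moreover from this have "compact (closure {x. dir_deriv v \<phi> x \<noteq> 0})"
    using sub compact_Int_closed[of ?K "closure {x. dir_deriv v \<phi> x \<noteq> 0}"]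
    by (simp add: Int_absorb1)
  ultimately show ?thesis unfolding test_functions_def by auto
qed

lemma linear_dir_deriv: "linear (\<lambda>v. dir_deriv v \<phi> x)"
  using test_function_has_derivative by (rule has_derivative_linear)

end

section \<open>Translation, dilation and integrals of directional derivatives\<close>

lemma lborel_integral_translate:
  fixes f :: "'a::euclidean_space \<Rightarrow> real"
  assumes [measurable]: "f \<in> borel_measurable borel"
  shows "(LINT x|lborel. f (x + c)) = (LINT x|lborel. f x)"
proof -
  have "(LINT x|lborel. f x) = (LINT x|distr lborel borel ((+) c). f x)"
    by (simp only: lborel_distr_plus)
  also have "\<dots> = (LINT x|lborel. f (c + x))"
    by (rule integral_distr) auto
  finally show ?thesis by (simp add: add.commute)
qed

lemma lborel_integral_scale:
  fixes f :: "'a::euclidean_space \<Rightarrow> real"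
  assumes [measurable]: "f \<in> borel_measurable borel" and "0 < t"
  shows "(LINT x|lborel. f x) = t ^ DIM('a) * (LINT x|lborel. f (t *\<^sub>R x))"
proof -
  have "(LINT x|lborel. f x)
      = (LINT x|density (distr lborel borel (\<lambda>x. 0 + t *\<^sub>R x)) (\<lambda>_. ennreal (\<bar>t\<bar> ^ DIM('a))). f x)"
    using assms(2) by (subst lborel_affine[of t 0]) (auto simp: ennreal_power)
  also have "\<dots> = (LINT x|distr lborel borel (\<lambda>x. 0 + t *\<^sub>R x). \<bar>t\<bar> ^ DIM('a) * f x)"
    by (subst integral_density) auto
  also have "\<dots> = (LINT x|lborel. t ^ DIM('a) * f (t *\<^sub>R x))"
    using assms(2) by (subst integral_distr) auto
  finally show ?thesis by simp
qed

text \<open>Translation invariance makes the integral of every difference quotient vanish.\<close>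

lemma integral_line_derivative_eq_0:
  fixes F G :: "'a::euclidean_space \<Rightarrow> real"
  assumes F [measurable]: "F \<in> borel_measurable borel"
    and G [measurable]: "G \<in> borel_measurable borel"
    and S: "bounded S" and F0: "\<And>x. x \<notin> S \<Longrightarrow> F x = 0"
    and FB: "\<And>x. \<bar>F x\<bar> \<le> B" and GB: "\<And>x. \<bar>G x\<bar> \<le> B"
    and deriv: "\<And>x. ((\<lambda>s. F (x + s *\<^sub>R v)) has_real_derivative G x) (at 0)"
  shows "(LINT x|lborel. G x) = 0"
proof -
  define h where "h m = inverse (real (Suc m))" for m
  define D where "D m x = (F (x + h m *\<^sub>R v) - F x) / h m" for m x
  have h: "0 < h m" "h m \<le> 1" for m by (auto simp: h_def inverse_le_1_iff)
  have shift [measurable]: "(\<lambda>x. F (x + c)) \<in> borel_measurable borel" for c by measurable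
  have F_int: "integrable lborel F"
    by (rule integrable_bounded_support[OF F S F0 FB])
  \<comment> \<open>The assumption gives the derivative at s = 0 for every base point; moving the
    base point gives it along the whole line, as the mean value theorem requires.\<close>
  have deriv': "((\<lambda>s. F (x + s *\<^sub>R v)) has_real_derivative G (x + s *\<^sub>R v)) (at s)" for x s
  proof -
    have "(\<lambda>r. F (x + (r + s) *\<^sub>R v)) = (\<lambda>r. F ((x + s *\<^sub>R v) + r *\<^sub>R v))"
      by (simp add: algebra_simps)
    then show ?thesis
      using deriv[of "x + s *\<^sub>R v"] DERIV_shift[of "\<lambda>s. F (x + s *\<^sub>R v)" _ 0 s] by simp
  qed
  \<comment> \<open>Each difference quotient is a value of G at an intermediate point, so the bound
    on G is a majorant independent of m.\<close>
  have D_bound: "\<bar>D m x\<bar> \<le> B" for m x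
  proof -
    obtain z where "F (x + h m *\<^sub>R v) - F (x + 0 *\<^sub>R v) = (h m - 0) * G (x + z *\<^sub>R v)"
      using MVT2[OF h(1) deriv'] by blast
    then have "D m x = G (x + z *\<^sub>R v)" using h(1)[of m] by (simp add: D_def)
    then show ?thesis using GB by simp
  qed
  have D_lim: "(\<lambda>m. D m x) \<longlonglongrightarrow> G x" for x
  proof -
    have "((\<lambda>s. (F (x + s *\<^sub>R v) - F x) / s) \<longlongrightarrow> G x) (at 0)"
      using deriv[of x] by (simp add: has_field_derivative_iff)
    moreover have "filterlim h (at 0) sequentially"
      unfolding filterlim_at h_def
      using LIMSEQ_inverse_real_of_nat by (auto intro: always_eventually)
    ultimately show ?thesis unfolding D_def by (rule filterlim_compose)
  qed
  have D_0: "(LINT x|lborel. D m x) = 0" for m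
  proof -
    obtain R where R: "S \<subseteq> ball 0 R" using S bounded_subset_ballD by blast
    have "integrable lborel (\<lambda>x. F (x + h m *\<^sub>R v))"
    proof (rule integrable_bounded_support)
      show "bounded (ball (- (h m *\<^sub>R v)) R)" by simp
      show "F (x + h m *\<^sub>R v) = 0" if "x \<notin> ball (- (h m *\<^sub>R v)) R" for x
        using that R by (intro F0) (auto simp: dist_norm norm_minus_commute add.commute subset_iff)
    qed (use FB in auto)
    then show ?thesis
      unfolding D_def using F_int lborel_integral_translate[OF F, of "h m *\<^sub>R v"] by simp
  qed
  obtain R where R: "S \<subseteq> ball 0 R" using S bounded_subset_ballD by blast
  \<comment> \<open>The step sizes are at most 1, so all quotients live on one fixed ball and the
    constant bound becomes integrable.\<close>
  have D_supp: "D m x = 0" if "x \<notin> ball 0 (R + norm v)" for m x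
  proof -
    have "norm (h m *\<^sub>R v) \<le> norm v"
      using h[of m] by (simp add: mult_left_le_one_le)
    then have "R \<le> norm (x + h m *\<^sub>R v)" "R \<le> norm x"
      using that norm_diff_ineq[of x "h m *\<^sub>R v"] norm_ge_zero[of v]
      by (simp_all only: mem_ball_0 not_less)
    then have "x + h m *\<^sub>R v \<notin> S" "x \<notin> S" using R by (auto simp: subset_iff)
    then show ?thesis by (simp add: D_def F0)
  qed
  have "(\<lambda>m. LINT x|lborel. D m x) \<longlonglongrightarrow> (LINT x|lborel. G x)"
  proof (rule integral_dominated_convergence)
    show "integrable lborel (\<lambda>x. indicator (ball 0 (R + norm v)) x * B)"
      by (rule integrable_bounded_support[where S="ball 0 (R + norm v)" and B="\<bar>B\<bar>"])
         (auto intro!: borel_measurable_times borel_measurable_indicator borel_open split: split_indicator)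
    show "AE x in lborel. norm (D m x) \<le> indicator (ball 0 (R + norm v)) x * B" for m
    proof (rule AE_I2)
      fix x
      show "norm (D m x) \<le> indicator (ball 0 (R + norm v)) x * B"
        using D_bound[of m x] D_supp[of x m] by (cases "x \<in> ball 0 (R + norm v)") auto
    qed
    show "D m \<in> borel_measurable lborel" for m unfolding D_def by measurable
  qed (use D_lim in auto)
  then show ?thesis by (simp add: D_0 LIMSEQ_const_iff)
qed

section \<open>Distributions with bounded Borel representatives on Q\<close>

lemma test_function_borel:
  "\<phi> \<in> test_functions S \<Longrightarrow> \<phi> \<in> borel_measurable borel"
  by (intro borel_measurable_continuous_onI test_function_continuous)

text \<open>A Borel representative is needed because \<open>rho_n\<close> is unspecified on the interfaces.\<close>

definition bounded_version_on_Q ::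
    "(real \<times> (real^'d) \<Rightarrow> real) \<Rightarrow> (real \<times> (real^'d) \<Rightarrow> real) \<Rightarrow> bool" where
  "bounded_version_on_Q f g \<longleftrightarrow>
     g \<in> borel_measurable borel \<and> (\<exists>C. \<forall>x\<in>Q. \<bar>g x\<bar> \<le> C) \<and> (AE x in lborel. x \<in> Q \<longrightarrow> f x = g x)"

lemma bounded_version_on_Q_mult:
  assumes "bounded_version_on_Q f1 g1" "bounded_version_on_Q f2 g2"
  shows "bounded_version_on_Q (\<lambda>x. f1 x * f2 x) (\<lambda>x. g1 x * g2 x)"
  unfolding bounded_version_on_Q_def
proof (intro conjI)
  obtain C1 C2 where C: "\<And>x. x \<in> Q \<Longrightarrow> \<bar>g1 x\<bar> \<le> C1" "\<And>x. x \<in> Q \<Longrightarrow> \<bar>g2 x\<bar> \<le> C2"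
    using assms unfolding bounded_version_on_Q_def by blast
  have "\<bar>g1 x * g2 x\<bar> \<le> C1 * C2" if "x \<in> Q" for x
    using C[OF that] by (simp add: abs_mult mult_mono')
  then show "\<exists>C. \<forall>x\<in>Q. \<bar>g1 x * g2 x\<bar> \<le> C" by blast
  show "AE x in lborel. x \<in> Q \<longrightarrow> f1 x * f2 x = g1 x * g2 x"
  proof -
    have "AE x in lborel. x \<in> Q \<longrightarrow> f1 x = g1 x" "AE x in lborel. x \<in> Q \<longrightarrow> f2 x = g2 x"
      using assms by (simp_all add: bounded_version_on_Q_def)
    then show ?thesis by eventually_elim simp
  qed
qed (use assms in \<open>auto simp: bounded_version_on_Q_def intro: borel_measurable_times\<close>)

lemma locally_integrable_bounded_version:
  fixes f :: "real \<times> (real^'d) \<Rightarrow> real"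
  assumes "bounded_version_on_Q f g"
  shows "locally_integrable (interior Q) f"
  unfolding locally_integrable_def
proof (intro allI impI)
  fix K :: "(real \<times> (real^'d)) set" assume K: "compact K \<and> K \<subseteq> interior Q"
  then have KQ: "K \<subseteq> Q" using interior_subset by blast
  have K_sets [measurable]: "K \<in> sets borel" using K by (intro borel_compact) auto
  have [measurable]: "g \<in> borel_measurable borel"
    using assms by (simp add: bounded_version_on_Q_def)
  obtain C where C: "\<And>x. x \<in> Q \<Longrightarrow> \<bar>g x\<bar> \<le> C"
    using assms unfolding bounded_version_on_Q_def by blast
  have "integrable lborel (\<lambda>x. indicator K x * g x)"
  proof (rule integrable_bounded_support[OF _ bounded_Q])
    show "\<bar>indicator K x * g x\<bar> \<le> \<bar>C\<bar>" for x
      using C[of x] KQ by (auto split: split_indicator)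
  qed (use KQ in \<open>auto split: split_indicator\<close>)
  then have gK: "integrable (lebesgue_on K) g"
    by (simp add: integrable_restrict_space integrable_completion)
  have ae: "AE x in lebesgue_on K. g x = f x"
    using assms KQ by (auto simp: AE_lebesgue_on_iff bounded_version_on_Q_def elim!: eventually_mono)
  show "integrable (lebesgue_on K) f"
    by (rule integrable_cong_AE_imp[OF gK _ ae])
       (rule borel_measurable_lebesgue_on_AE[OF _ borel_measurable_integrable[OF gK] ae], simp)
qed

context
  fixes \<phi> :: "real \<times> (real^'d) \<Rightarrow> real"
  assumes \<phi>: "\<phi> \<in> test_functions (interior Q)"
begin

lemma test_function_eq_0_off_Q: "x \<notin> Q \<Longrightarrow> \<phi> x = 0"
  using test_function_eq_0[OF \<phi>] interior_subset by blast

lemma integrable_bounded_version_mult: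
  assumes "bounded_version_on_Q f g"
  shows "integrable lborel (\<lambda>x. g x * \<phi> x)"
proof -
  note test_function_borel[OF \<phi>, measurable]
  have [measurable]: "g \<in> borel_measurable borel"
    using assms by (simp add: bounded_version_on_Q_def)
  obtain C where C: "\<And>x. x \<in> Q \<Longrightarrow> \<bar>g x\<bar> \<le> C"
    using assms unfolding bounded_version_on_Q_def by blast
  obtain B where B: "\<And>x. \<bar>\<phi> x\<bar> \<le> B" "0 \<le> B" using test_function_bounded[OF \<phi>] by blast
  show ?thesis
  proof (rule integrable_bounded_support[OF _ bounded_Q])
    show "\<bar>g x * \<phi> x\<bar> \<le> \<bar>C\<bar> * B" for x
    proof (cases "x \<in> Q")
      case True
      then show ?thesis
        unfolding abs_mult using C[OF True] B(1)[of x] by (intro mult_mono) linarith+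
    qed (use B in \<open>simp add: test_function_eq_0_off_Q\<close>)
  qed (auto simp: test_function_eq_0_off_Q)
qed

text \<open>The test function vanishes off the interior of Q, so the integral extends to the whole
  space, where Fubini, translation and scaling are available.\<close>

lemma dist_of_bounded_version:
  assumes "bounded_version_on_Q f g"
  shows "dist_of (interior Q) f \<phi> = (LINT x|lborel. g x * \<phi> x)"
proof -
  note test_function_borel[OF \<phi>, measurable]
  have [measurable]: "g \<in> borel_measurable borel"
    using assms by (simp add: bounded_version_on_Q_def)
  have S: "interior (Q :: (real \<times> (real^'d)) set) \<in> sets lebesgue" by simp
  have ae: "AE x in lebesgue_on (interior Q). g x = f x"
    using assms interior_subset[of "Q :: (real \<times> (real^'d)) set"]
    by (auto simp: AE_lebesgue_on_iff[OF S] bounded_version_on_Q_def elim!: eventually_mono)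
  have g: "g \<in> borel_measurable (lebesgue_on (interior Q))"
    and p: "\<phi> \<in> borel_measurable (lebesgue_on (interior Q))"
    by (rule borel_measurable_lebesgue_onI; measurable)+
  have "dist_of (interior Q) f \<phi> = (LINT x|lebesgue_on (interior Q). g x * \<phi> x)"
    unfolding dist_of_def
  proof (rule integral_cong_AE)
    show "AE x in lebesgue_on (interior Q). f x * \<phi> x = g x * \<phi> x"
      using ae by eventually_elim simp
  qed (intro borel_measurable_times borel_measurable_lebesgue_on_AE[OF S g ae] g p)+
  also have "\<dots> = (LINT x|lebesgue. g x * \<phi> x)"
    using S by (subst integral_restrict_space)
      (auto simp: indicator_def test_function_eq_0[OF \<phi>] intro!: Bochner_Integration.integral_cong)
  also have "\<dots> = (LINT x|lborel. g x * \<phi> x)"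
    by (rule integral_completion) measurable
  finally show ?thesis .
qed

lemma test_function_line_derivative:
  "((\<lambda>s. \<phi> (x + s *\<^sub>R v)) has_real_derivative dir_deriv v \<phi> x) (at 0)"
proof -
  have "((\<lambda>s. x + s *\<^sub>R v) has_derivative (\<lambda>s. s *\<^sub>R v)) (at 0)"
    by (auto intro!: derivative_eq_intros)
  moreover have "(\<phi> has_derivative (\<lambda>v. dir_deriv v \<phi> x)) (at (x + 0 *\<^sub>R v))"
    using test_function_has_derivative[OF \<phi>, of x] by simp
  ultimately have "(\<phi> \<circ> (\<lambda>s. x + s *\<^sub>R v) has_derivative
      (\<lambda>v. dir_deriv v \<phi> x) \<circ> (\<lambda>s. s *\<^sub>R v)) (at 0)"
    by (rule diff_chain_at)
  then show ?thesis
    by (simp add: has_field_derivative_def o_def linear_cmul[OF linear_dir_deriv[OF \<phi>]] mult.commute[of _ "dir_deriv v \<phi> x"])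
qed

end

section \<open>Spatial derivatives: pressure gradient and viscous stress\<close>

lemma integral_time_profile_spatial_deriv:
  fixes \<phi> :: "real \<times> (real^'d) \<Rightarrow> real"
  assumes \<phi>: "\<phi> \<in> test_functions (interior Q)"
    and [measurable]: "g \<in> borel_measurable borel" and gB: "\<And>t. \<bar>g t\<bar> \<le> C"
  shows "(LINT x|lborel. g (fst x) * dir_deriv (0, w) \<phi> x) = 0"
proof -
  let ?\<psi> = "dir_deriv (0, w) \<phi>"
  note \<psi> = test_function_dir_deriv[OF \<phi>, of "(0, w)"]
  have [measurable]: "(\<lambda>x :: real \<times> (real^'d). g (fst x)) \<in> borel_measurable borel"
    unfolding borel_prod[symmetric] by measurable
  note test_function_borel[OF \<phi>, measurable] test_function_borel[OF \<psi>, measurable]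
  obtain B where B: "\<And>x. \<bar>\<phi> x\<bar> \<le> B" "0 \<le> B" using test_function_bounded[OF \<phi>] by blast
  obtain B' where B': "\<And>x. \<bar>?\<psi> x\<bar> \<le> B'" "0 \<le> B'" using test_function_bounded[OF \<psi>] by blast
  have C: "0 \<le> C" using gB[of 0] by linarith
  show ?thesis
  proof (rule integral_line_derivative_eq_0[where F="\<lambda>x. g (fst x) * \<phi> x" and v="(0, w)"
        and B="C * max B B'" and S=Q])
    show "\<bar>g (fst x) * \<phi> x\<bar> \<le> C * max B B'" for x
      unfolding abs_mult using gB[of "fst x"] B(1)[of x] C by (intro mult_mono) auto
    show "\<bar>g (fst x) * ?\<psi> x\<bar> \<le> C * max B B'" for x
      unfolding abs_mult using gB[of "fst x"] B'(1)[of x] C by (intro mult_mono) auto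
    \<comment> \<open>A move along (0, w) leaves the time fixed, so g is a constant factor here and
      may be discontinuous in t, as a cutoff to [1, 2] is.\<close>
    show "((\<lambda>s. g (fst (x + s *\<^sub>R (0, w))) * \<phi> (x + s *\<^sub>R (0, w)))
        has_real_derivative g (fst x) * ?\<psi> x) (at 0)" for x
      using DERIV_cmult[OF test_function_line_derivative[OF \<phi>, of x "(0, w)"], of "g (fst x)"]
      by simp
  qed (auto simp: bounded_Q test_function_eq_0_off_Q[OF \<phi>])
qed

lemma bounded_version_u_n:
  "bounded_version_on_Q (\<lambda>x. u_n n x $ i)
    (\<lambda>x :: real \<times> (real^'d). indicator {1..2} (fst x) / fst x * snd x $ i)"
  unfolding bounded_version_on_Q_def
proof (intro conjI)
  have "(\<lambda>x :: real \<times> (real^'d). snd x $ i) \<in> borel_measurable borel"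
    by (intro borel_measurable_continuous_onI continuous_intros)
  moreover have "(\<lambda>x :: real \<times> (real^'d). indicator {1..2} (fst x) / fst x) \<in> borel_measurable borel"
    unfolding borel_prod[symmetric] by measurable
  ultimately show "(\<lambda>x :: real \<times> (real^'d). indicator {1..2} (fst x) / fst x * snd x $ i)
      \<in> borel_measurable borel"
    by (intro borel_measurable_times)
  have "\<bar>indicator {1..2} (fst x) / fst x * snd x $ i\<bar> \<le> 1" if "x \<in> Q" for x :: "real \<times> (real^'d)"
    using that component_le_norm_cart[of "snd x" i]
    by (auto simp: Q_def abs_mult divide_le_eq)
  then show "\<exists>C. \<forall>x\<in>Q. \<bar>indicator {1..2} (fst x) / fst x * (snd x :: real^'d) $ i\<bar> \<le> C" by blast
  show "AE x in lborel. x \<in> Q \<longrightarrow>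
      u_n n x $ i = indicator {1..2} (fst x) / fst x * (snd x :: real^'d) $ i"
    by (intro AE_I2) (auto simp: u_n_def Q_def field_simps)
qed

text \<open>The derivative of y_i \<psi> / t along e_j is (\<delta>_ij \<psi> + y_i \<partial>_j
  \<psi>) / t and has integral zero. The first summand integrates to zero by itself because \<psi>
  is a spatial derivative, and so does the second, which is the claim.\<close>

lemma velocity_second_derivative_eq_0:
  fixes \<phi> :: "real \<times> (real^'d) \<Rightarrow> real"
  assumes \<phi>: "\<phi> \<in> test_functions (interior Q)"
  shows "dist_of (interior Q) (\<lambda>x. u_n n x $ i) (dir_deriv (e_y j) (dir_deriv (e_y k) \<phi>)) = 0"
proof -
  define \<psi> where "\<psi> = dir_deriv (e_y k) \<phi>"
  let ?\<chi> = "dir_deriv (e_y j) \<psi>"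
  define g :: "real \<Rightarrow> real" where "g t = indicator {1..2} t / t" for t
  have \<psi>: "\<psi> \<in> test_functions (interior Q)"
    unfolding \<psi>_def by (rule test_function_dir_deriv[OF \<phi>])
  have \<chi>: "?\<chi> \<in> test_functions (interior Q)" by (rule test_function_dir_deriv[OF \<psi>])
  have g [measurable]: "g \<in> borel_measurable borel" unfolding g_def by measurable
  have gB: "\<bar>g t\<bar> \<le> 1" for t by (auto simp: g_def split: split_indicator)
  have g_meas [measurable]: "(\<lambda>x :: real \<times> (real^'d). g (fst x)) \<in> borel_measurable borel"
    unfolding borel_prod[symmetric] by measurable
  have y_meas [measurable]: "(\<lambda>x :: real \<times> (real^'d). snd x $ i) \<in> borel_measurable borel"
    by (intro borel_measurable_continuous_onI continuous_intros)
  note test_function_borel[OF \<psi>, measurable] test_function_borel[OF \<chi>, measurable]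
  obtain B where B: "\<And>x. \<bar>\<psi> x\<bar> \<le> B" "0 \<le> B" using test_function_bounded[OF \<psi>] by blast
  obtain B' where B': "\<And>x. \<bar>?\<chi> x\<bar> \<le> B'" "0 \<le> B'" using test_function_bounded[OF \<chi>] by blast
  let ?\<delta> = "axis j 1 $ i :: real"
  have \<delta>: "\<bar>?\<delta>\<bar> \<le> 1" by (simp add: axis_def)
  have y1: "\<bar>snd x $ i\<bar> \<le> 1" if "x \<in> Q" for x :: "real \<times> (real^'d)"
    using that component_le_norm_cart[of "snd x" i] by (auto simp: Q_def)
  have y\<psi>: "\<bar>snd x $ i * \<psi> x\<bar> \<le> B" "\<bar>snd x $ i * ?\<chi> x\<bar> \<le> B'" for x
  proof -
    have "\<bar>snd x $ i * \<psi> x\<bar> \<le> 1 * B \<and> \<bar>snd x $ i * ?\<chi> x\<bar> \<le> 1 * B'"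
    proof (cases "x \<in> Q")
      case True
      then show ?thesis unfolding abs_mult using y1[OF True] B(1)[of x] B'(1)[of x]
        by (intro conjI mult_mono) linarith+
    qed (use B B' in \<open>simp add: test_function_eq_0_off_Q[OF \<psi>] test_function_eq_0_off_Q[OF \<chi>]\<close>)
    then show "\<bar>snd x $ i * \<psi> x\<bar> \<le> B" "\<bar>snd x $ i * ?\<chi> x\<bar> \<le> B'" by simp_all
  qed
  have zero: "(LINT x|lborel. g (fst x) * (?\<delta> * \<psi> x + snd x $ i * ?\<chi> x)) = 0"
  proof (rule integral_line_derivative_eq_0[where F="\<lambda>x. g (fst x) * (snd x $ i * \<psi> x)"
        and v="e_y j" and B="B + B'" and S=Q])
    show "\<bar>g (fst x) * (snd x $ i * \<psi> x)\<bar> \<le> B + B'" for x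
      using mult_mono[OF gB[of "fst x"] y\<psi>(1)[of x]] B'(2) by (simp add: abs_mult)
    have "\<bar>?\<delta> * \<psi> x\<bar> \<le> 1 * B" for x
      unfolding abs_mult using \<delta> B(1)[of x] by (intro mult_mono) linarith+
    then have s: "\<bar>?\<delta> * \<psi> x + snd x $ i * ?\<chi> x\<bar> \<le> B + B'" for x
      using y\<psi>(2)[of x] by (intro order_trans[OF abs_triangle_ineq] add_mono) auto
    then show "\<bar>g (fst x) * (?\<delta> * \<psi> x + snd x $ i * ?\<chi> x)\<bar> \<le> B + B'" for x
      using mult_mono[OF gB[of "fst x"] s[of x]] B(2) B'(2)
      by (simp add: abs_mult)
    show "((\<lambda>s. g (fst (x + s *\<^sub>R e_y j)) * (snd (x + s *\<^sub>R e_y j) $ i * \<psi> (x + s *\<^sub>R e_y j)))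
        has_real_derivative g (fst x) * (?\<delta> * \<psi> x + snd x $ i * ?\<chi> x)) (at 0)" for x
    proof -
      have "((\<lambda>s. snd x $ i + s * ?\<delta>) has_real_derivative ?\<delta>) (at 0)"
        by (auto intro!: derivative_eq_intros)
      from DERIV_cmult[OF DERIV_mult[OF this test_function_line_derivative[OF \<psi>, of x "e_y j"]],
          of "g (fst x)"]
      have "((\<lambda>s. g (fst x) * ((snd x $ i + s * ?\<delta>) * \<psi> (x + s *\<^sub>R e_y j)))
          has_real_derivative g (fst x) * (?\<delta> * \<psi> x + ?\<chi> x * snd x $ i)) (at 0)"
        by (simp only: scaleR_zero_left add_0_right mult_zero_left)
      moreover have "fst (x + s *\<^sub>R e_y j) = fst x" "snd (x + s *\<^sub>R e_y j) $ i = snd x $ i + s * ?\<delta>"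
        for s by simp_all
      ultimately show ?thesis by (simp only: mult.commute[of "?\<chi> x"])
    qed
  qed (auto simp: bounded_Q test_function_eq_0_off_Q[OF \<psi>])
  have int1: "integrable lborel (\<lambda>x. ?\<delta> * (g (fst x) * \<psi> x))"
  proof (intro integrable_mult_right integrable_bounded_version_mult[OF \<psi>])
    show "bounded_version_on_Q (\<lambda>x :: real \<times> (real^'d). g (fst x)) (\<lambda>x. g (fst x))"
      using gB g_meas by (auto simp: bounded_version_on_Q_def)
  qed
  note v = bounded_version_u_n[of n i, folded g_def]
  have int2: "integrable lborel (\<lambda>x. g (fst x) * snd x $ i * ?\<chi> x)"
    by (rule integrable_bounded_version_mult[OF \<chi> v])
  have "(LINT x|lborel. ?\<delta> * (g (fst x) * \<psi> x)) = 0"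
    unfolding \<psi>_def using integral_time_profile_spatial_deriv[OF \<phi> g gB, where w="axis k 1"] by simp
  moreover have "(LINT x|lborel. g (fst x) * (?\<delta> * \<psi> x + snd x $ i * ?\<chi> x))
      = (LINT x|lborel. ?\<delta> * (g (fst x) * \<psi> x)) + (LINT x|lborel. g (fst x) * snd x $ i * ?\<chi> x)"
    unfolding Bochner_Integration.integral_add[OF int1 int2, symmetric]
    by (rule Bochner_Integration.integral_cong) (auto simp: algebra_simps)
  ultimately have "(LINT x|lborel. g (fst x) * snd x $ i * ?\<chi> x) = 0"
    using zero by linarith
  then show ?thesis
    unfolding dist_of_bounded_version[OF \<chi> v] \<psi>_def[symmetric] .
qed

section \<open>Transport of densities carried by the rays y = t z\<close>

definition self_similar :: "(real^'d \<Rightarrow> real) \<Rightarrow> real \<times> (real^'d) \<Rightarrow> real" where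
  "self_similar c x = indicator {1..2} (fst x) * (c (snd x /\<^sub>R fst x) / fst x ^ CARD('d))"

text \<open>The cutoff to t in [1, 2] inside \<open>self_similar\<close> keeps the dilution factor
  1/t^d at most 1, so a bound on the profile is a bound on the density.\<close>

lemma bounded_version_self_similar:
  fixes c :: "real^'d \<Rightarrow> real"
  assumes [measurable]: "c \<in> borel_measurable borel" and cB: "\<And>z. \<bar>c z\<bar> \<le> C"
    and ae: "AE x in lborel. x \<in> Q \<longrightarrow> m x = c (snd x /\<^sub>R fst x) / fst x ^ CARD('d)"
  shows "bounded_version_on_Q m (self_similar c)"
  unfolding bounded_version_on_Q_def
proof (intro conjI)
  show "self_similar c \<in> borel_measurable borel"
    unfolding self_similar_def[abs_def] borel_prod[symmetric] by measurable
  have "\<bar>self_similar c x\<bar> \<le> C" for x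
  proof (cases "fst x \<in> {1..2}")
    case True
    then have "\<bar>c (snd x /\<^sub>R fst x)\<bar> / fst x ^ CARD('d) \<le> \<bar>c (snd x /\<^sub>R fst x)\<bar> / 1"
      by (intro divide_left_mono) auto
    also have "\<dots> \<le> C" using cB by simp
    finally show ?thesis using True by (simp add: self_similar_def)
  next
    case False
    then show ?thesis using order_trans[OF abs_ge_zero cB] by (simp add: self_similar_def)
  qed
  then show "\<exists>C. \<forall>x\<in>Q. \<bar>self_similar c x\<bar> \<le> C" by blast
  show "AE x in lborel. x \<in> Q \<longrightarrow> m x = self_similar c x"
    using ae by eventually_elim (auto simp: self_similar_def Q_def)
qed

text \<open>In the coordinates \<open>(t, z)\<close> with \<open>y = t z\<close> the transport operator
  \<open>\<partial>\<^sub>t + u \<cdot> \<nabla>\<close> is the plain time derivative, and the Jacobian \<open>t\<^sup>d\<close> cancels the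
  decay of the density.\<close>

lemma self_similar_transport:
  fixes c :: "real^'d \<Rightarrow> real"
  assumes \<phi>: "\<phi> \<in> test_functions (interior Q)"
    and c [measurable]: "c \<in> borel_measurable borel" and cB: "\<And>z. \<bar>c z\<bar> \<le> C"
  shows "(LINT x|lborel. self_similar c x * dir_deriv e_t \<phi> x
    + (\<Sum>j\<in>UNIV. self_similar c x * (indicator {1..2} (fst x) / fst x * snd x $ j)
        * dir_deriv (e_y j) \<phi> x)) = 0"
    (is "(LINT x|lborel. ?H x) = 0")
    and "integrable lborel (\<lambda>x. self_similar c x * dir_deriv e_t \<phi> x)"
    and "\<And>j. integrable lborel (\<lambda>x. self_similar c x
      * (indicator {1..2} (fst x) / fst x * snd x $ j) * dir_deriv (e_y j) \<phi> x)"
proof -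
  let ?D = "\<lambda>v. dir_deriv v \<phi>"
  note D = test_function_dir_deriv[OF \<phi>]
  define G where "G x = c (snd x) * (?D e_t (fst x, fst x *\<^sub>R snd x)
      + (\<Sum>j\<in>UNIV. snd x $ j * ?D (e_y j) (fst x, fst x *\<^sub>R snd x)))" for x
  have vg: "bounded_version_on_Q (self_similar c) (self_similar c)"
    using bounded_version_self_similar[OF c cB, of "\<lambda>x. c (snd x /\<^sub>R fst x) / fst x ^ CARD('d)"]
    by (simp add: bounded_version_on_Q_def)
  show int1: "integrable lborel (\<lambda>x. self_similar c x * ?D e_t x)"
    by (rule integrable_bounded_version_mult[OF D vg])
  show int2: "integrable lborel (\<lambda>x. self_similar c x
      * (indicator {1..2} (fst x) / fst x * snd x $ j) * ?D (e_y j) x)" for j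
    by (rule integrable_bounded_version_mult[OF D bounded_version_on_Q_mult[OF vg bounded_version_u_n]])
  have H_int: "integrable lborel ?H"
    by (intro Bochner_Integration.integrable_add Bochner_Integration.integrable_sum int1 int2)
  \<comment> \<open>Q is not invariant under the change to z = y/t, but dividing by t \<ge> 1
    shrinks y, so functions supported in Q remain so in the new coordinates.\<close>
  have in_Q: "(t, z) \<in> Q" if "(t, t *\<^sub>R z) \<in> Q" for t and z :: "real^'d"
  proof -
    have "1 \<le> t" "t * norm z < 1" using that by (auto simp: Q_def)
    then have "norm z < 1" using mult_right_mono[of 1 t "norm z"] by simp
    then show ?thesis using that by (simp add: Q_def)
  qed
  have D_line: "?D (1, z) x = ?D e_t x + (\<Sum>j\<in>UNIV. z $ j * ?D (e_y j) x)" for z x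
  proof -
    have "(1, z) = e_t + (\<Sum>j\<in>UNIV. z $ j *\<^sub>R e_y j)"
      by (simp add: prod_eq_iff fst_sum snd_sum vec_eq_iff axis_def if_distrib cong: if_cong)
    then show ?thesis
      by (simp only: linear_add[OF linear_dir_deriv[OF \<phi>]] linear_sum[OF linear_dir_deriv[OF \<phi>]]
          linear_cmul[OF linear_dir_deriv[OF \<phi>]] real_scaleR_def)
  qed
  have to_tz: "(\<lambda>x :: real \<times> (real^'d). (fst x, fst x *\<^sub>R snd x)) \<in> borel_measurable borel"
    by (intro borel_measurable_continuous_onI continuous_intros)
  have D_meas [measurable]:
    "(\<lambda>x :: real \<times> (real^'d). ?D v (fst x, fst x *\<^sub>R snd x)) \<in> borel_measurable borel" for v
    by (rule measurable_compose[OF to_tz test_function_borel[OF D]])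
  have \<phi>_meas [measurable]:
    "(\<lambda>x :: real \<times> (real^'d). \<phi> (fst x, fst x *\<^sub>R snd x)) \<in> borel_measurable borel"
    by (rule measurable_compose[OF to_tz test_function_borel[OF \<phi>]])
  have c_meas [measurable]: "(\<lambda>x :: real \<times> (real^'d). c (snd x)) \<in> borel_measurable borel"
    unfolding borel_prod[symmetric] by measurable
  have z_meas [measurable]: "(\<lambda>x :: real \<times> (real^'d). snd x $ j) \<in> borel_measurable borel" for j
    by (intro borel_measurable_continuous_onI continuous_intros)
  have G_meas [measurable]: "G \<in> borel_measurable borel" unfolding G_def by measurable
  have C: "0 \<le> C" by (rule order_trans[OF abs_ge_zero cB])
  have "\<exists>B. (\<forall>x. \<bar>?D v x\<bar> \<le> B) \<and> 0 \<le> B" for v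
    by (rule test_function_bounded[OF D[of v]]) blast
  then obtain B where B: "\<And>v x. \<bar>?D v x\<bar> \<le> B v" "\<And>v. 0 \<le> B v"
    by metis
  obtain B' where B': "\<And>x. \<bar>\<phi> x\<bar> \<le> B'" "0 \<le> B'"
    using test_function_bounded[OF \<phi>] by blast
  let ?B = "B e_t + (\<Sum>j\<in>UNIV. B (e_y j))"
  have zD: "\<bar>snd x $ j * ?D v (fst x, fst x *\<^sub>R snd x)\<bar> \<le> B v" for j v and x :: "real \<times> (real^'d)"
  proof (cases "(fst x, fst x *\<^sub>R snd x) \<in> Q")
    case True
    then have "norm (snd x) < 1" using in_Q by (fastforce simp: Q_def)
    then have "\<bar>snd x $ j\<bar> \<le> 1" using component_le_norm_cart[of "snd x" j] by linarith
    then have "\<bar>snd x $ j\<bar> * \<bar>?D v (fst x, fst x *\<^sub>R snd x)\<bar> \<le> 1 * B v"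
      using B by (intro mult_mono) auto
    then show ?thesis by (simp add: abs_mult)
  next
    case False
    then show ?thesis using B(2)[of v] by (simp add: test_function_eq_0_off_Q[OF D])
  qed
  have G_bound: "\<bar>G x\<bar> \<le> C * ?B" for x
  proof -
    have "\<bar>?D e_t (fst x, fst x *\<^sub>R snd x)
        + (\<Sum>j\<in>UNIV. snd x $ j * ?D (e_y j) (fst x, fst x *\<^sub>R snd x))\<bar> \<le> ?B"
      by (intro order_trans[OF abs_triangle_ineq] add_mono B order_trans[OF sum_abs] sum_mono zD)
    then show ?thesis
      unfolding G_def abs_mult using cB C by (intro mult_mono) auto
  qed
  have B_nonneg: "0 \<le> ?B" using B(2) by (intro add_nonneg_nonneg sum_nonneg) auto
  have G_0: "G x = 0" if "x \<notin> Q" for x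
  proof -
    have "(fst x, fst x *\<^sub>R snd x) \<notin> Q" using that in_Q[of "fst x" "snd x"] by auto
    then show ?thesis by (simp add: G_def test_function_eq_0_off_Q[OF D])
  qed
  have "(LINT x|lborel. G x) = 0"
  \<comment> \<open>Along \<open>e_t\<close> the coordinate z is fixed, so c(z) is a constant factor
    and its jumps are never differentiated; \<open>D_line\<close> identifies the resulting
    derivative with that of \<phi> in the direction (1, z).\<close>
  proof (rule integral_line_derivative_eq_0[where
        F="\<lambda>x. c (snd x) * \<phi> (fst x, fst x *\<^sub>R snd x)" and v=e_t and S=Q and B="C * (?B + B')"])
    show "c (snd x) * \<phi> (fst x, fst x *\<^sub>R snd x) = 0" if "x \<notin> Q" for x
    proof -
      have "(fst x, fst x *\<^sub>R snd x) \<notin> Q" using that in_Q[of "fst x" "snd x"] by auto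
      then show ?thesis by (simp add: test_function_eq_0_off_Q[OF \<phi>])
    qed
    show "\<bar>c (snd x) * \<phi> (fst x, fst x *\<^sub>R snd x)\<bar> \<le> C * (?B + B')" for x
    proof -
      have "\<bar>\<phi> (fst x, fst x *\<^sub>R snd x)\<bar> \<le> ?B + B'"
        using B'(1)[of "(fst x, fst x *\<^sub>R snd x)"] B_nonneg by linarith
      then show ?thesis unfolding abs_mult using cB C by (intro mult_mono) auto
    qed
    show "\<bar>G x\<bar> \<le> C * (?B + B')" for x
      using G_bound[of x] mult_left_mono[of ?B "?B + B'" C] B'(2) C by linarith
    show "((\<lambda>s. c (snd (x + s *\<^sub>R e_t)) * \<phi> (fst (x + s *\<^sub>R e_t), fst (x + s *\<^sub>R e_t) *\<^sub>R snd (x + s *\<^sub>R e_t)))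
        has_real_derivative G x) (at 0)" for x
    proof -
      have Gx: "G x = c (snd x) * ?D (1, snd x) (fst x, fst x *\<^sub>R snd x)"
        unfolding G_def D_line[of "snd x"] ..
      have line: "(fst (x + s *\<^sub>R e_t), fst (x + s *\<^sub>R e_t) *\<^sub>R snd (x + s *\<^sub>R e_t))
          = (fst x, fst x *\<^sub>R snd x) + s *\<^sub>R (1, snd x)" for s
        by (simp add: algebra_simps)
      have "snd (x + s *\<^sub>R e_t) = snd x" for s by simp
      then show ?thesis
        unfolding Gx line
        using DERIV_cmult[OF test_function_line_derivative[OF \<phi>,
              of "(fst x, fst x *\<^sub>R snd x)" "(1, snd x)"], of "c (snd x)"]
        by (simp only:)
    qed
  qed (auto simp: bounded_Q)
  moreover have "integrable lborel G"
    by (rule integrable_bounded_support[OF G_meas bounded_Q G_0 G_bound])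
  ultimately have G_iterated: "(LINT t|lborel. LINT z|lborel. G (t, z)) = 0"
    using lborel_integral_Pair(1) by metis
  \<comment> \<open>The substitution y = t z at fixed t. For t outside [1, 2] both integrands
    vanish, which also covers t \<le> 0, where no scaling is possible.\<close>
  have slice: "(LINT y|lborel. ?H (t, y)) = (LINT z|lborel. G (t, z))" for t
  proof (cases "t \<in> {1..2}")
    case True
    have "(\<lambda>y. (t, y)) \<in> borel_measurable (borel :: (real^'d) measure)"
      by (intro borel_measurable_continuous_onI continuous_intros)
    moreover have "?H \<in> borel_measurable borel"
      using borel_measurable_integrable[OF H_int] by simp
    ultimately have "(\<lambda>y. ?H (t, y)) \<in> borel_measurable borel"
      by (rule measurable_compose)
    then have "(LINT y|lborel. ?H (t, y)) = t ^ CARD('d) * (LINT z|lborel. ?H (t, t *\<^sub>R z))"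
      using True by (subst lborel_integral_scale[where t=t]) auto
    also have "\<dots> = (LINT z|lborel. t ^ CARD('d) * ?H (t, t *\<^sub>R z))"
      by (rule integral_mult_right_zero[symmetric])
    also have "\<dots> = (LINT z|lborel. G (t, z))"
    proof (rule Bochner_Integration.integral_cong)
      fix z :: "real^'d"
      have "self_similar c (t, t *\<^sub>R z) = c z / t ^ CARD('d)"
        using True by (simp add: self_similar_def)
      moreover have "indicator {1..2} t / t * (t *\<^sub>R z) $ j = z $ j" for j
        using True by simp
      ultimately show "t ^ CARD('d) * ?H (t, t *\<^sub>R z) = G (t, z)"
        using True by (simp add: G_def sum_distrib_left distrib_left mult.assoc)
    qed simp
    finally show ?thesis .
  next
    case False
    then have "?H (t, y) = 0" "G (t, y) = 0" for y
      using G_0[of "(t, y)"] by (auto simp: self_similar_def Q_def)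
    then show ?thesis by simp
  qed
  show "(LINT x|lborel. ?H x) = 0"
    unfolding lborel_integral_Pair(1)[OF H_int] slice by (rule G_iterated)
qed

text \<open>Stated for a general profile so that it applies both to the density and to each momentum
  component.\<close>

lemma weak_transport:
  fixes c :: "real^'d \<Rightarrow> real"
  assumes \<phi>: "\<phi> \<in> test_functions (interior Q)"
    and c: "c \<in> borel_measurable borel" and cB: "\<And>z. \<bar>c z\<bar> \<le> C"
    and ae: "AE x in lborel. x \<in> Q \<longrightarrow> m x = c (snd x /\<^sub>R fst x) / fst x ^ CARD('d)"
  shows "dist_deriv e_t (dist_of (interior Q) m) \<phi>
    + (\<Sum>j\<in>UNIV. dist_deriv (e_y j) (dist_of (interior Q) (\<lambda>x. m x * u_n n x $ j)) \<phi>) = 0"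
proof -
  note v = bounded_version_self_similar[OF c cB ae]
  note D = test_function_dir_deriv[OF \<phi>]
  note t = self_similar_transport[OF \<phi> c cB]
  show ?thesis
    unfolding dist_deriv_def dist_of_bounded_version[OF D v]
      dist_of_bounded_version[OF D bounded_version_on_Q_mult[OF v bounded_version_u_n]]
    using t(1) t(2,3)
    by (simp add: Bochner_Integration.integral_add Bochner_Integration.integral_sum sum_negf)
qed

section \<open>The weak solutions and the combined statement\<close>

lemma admissible_pos:
  assumes "admissible d \<theta> a b p"
  shows "0 < a" "0 < b"
proof -
  show "0 < a" using assms by (simp add: admissible_def zero_less_divide_iff)
  then have "0 < b / 2 ^ d" using assms by (simp add: admissible_def)
  then show "0 < b" by (simp add: zero_less_divide_iff)
qed

text \<open>The momentum balance holds because its three groups vanish separately: the inertia as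
  transport of \<rho> u_i, the pressure gradient, and the divergence of the stress.\<close>

lemma weak_solution_rho_n:
  assumes adm: "admissible CARD('d) \<theta> a b p" and n: "n \<ge> 1"
  shows "weak_solution_NS (interior (Q :: (real \<times> (real^'d)) set)) \<mu> lam p (rho_n \<theta> a b n) (u_n n)"
proof -
  let ?\<Omega> = "interior (Q :: (real \<times> (real^'d)) set)"
  have theta: "0 < \<theta>" "\<theta> < 1" using adm by (auto simp: admissible_def)
  note ab = admissible_pos[OF adm]
  define c where "c z = (if frac (real n * norm z) < \<theta> then a else b)" for z :: "real^'d"
  have c [measurable]: "c \<in> borel_measurable borel" unfolding c_def frac_def by measurable
  have cB: "\<bar>c z\<bar> \<le> max a b" for z using ab by (auto simp: c_def)
  have ae: "AE x in lborel. x \<in> Q \<longrightarrow> rho_n \<theta> a b n (x :: real \<times> (real^'d))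
      = c (snd x /\<^sub>R fst x) / fst x ^ CARD('d)"
    using AE_rho_n[OF theta n, of a b]
  proof eventually_elim
    case (elim x)
    have "real n * norm (snd x /\<^sub>R fst x) = real n * norm (snd x) / fst x" if "x \<in> Q"
      using that by (auto simp: Q_def divide_inverse)
    then show ?case using elim by (simp add: c_def)
  qed
  note v_rho = bounded_version_self_similar[OF c cB ae]
  note v_u = bounded_version_u_n[where 'd='d, of n]
  define g where "g t = indicator {1..2} t *\<^sub>R p (a / t ^ CARD('d))" for t
  have p_cont: "continuous_on {0<..} p" using adm by (simp add: admissible_def)
  obtain C where C: "\<And>t. t \<in> {1..2} \<Longrightarrow> \<bar>p (a / t ^ CARD('d))\<bar> \<le> C"
    and cont: "continuous_on {1..2} (\<lambda>t. p (a / t ^ CARD('d)))"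
    using bounded_pressure_profile[OF p_cont ab(1)] by blast
  have g: "g \<in> borel_measurable borel"
    unfolding g_def[abs_def] by (rule borel_measurable_continuous_on_indicator[OF _ cont]) simp
  have gB: "\<bar>g t\<bar> \<le> max 0 C" for t using C by (auto simp: g_def indicator_def le_max_iff_disj)
  have v_p: "bounded_version_on_Q (\<lambda>x :: real \<times> (real^'d). p (rho_n \<theta> a b n x)) (\<lambda>x. g (fst x))"
    unfolding bounded_version_on_Q_def
  proof (intro conjI)
    note g [measurable]
    show "(\<lambda>x :: real \<times> (real^'d). g (fst x)) \<in> borel_measurable borel"
      unfolding borel_prod[symmetric] by measurable
    show "\<exists>C. \<forall>x\<in>Q :: (real \<times> (real^'d)) set. \<bar>g (fst x)\<bar> \<le> C" using gB by blast
    have peq: "p (b / t ^ CARD('d)) = p (a / t ^ CARD('d))" if "t \<in> {1..2}" for t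
      using adm that by (simp add: admissible_def)
    show "AE x in lborel. x \<in> Q \<longrightarrow> p (rho_n \<theta> a b n (x :: real \<times> (real^'d))) = g (fst x)"
      using ae by eventually_elim (auto simp: c_def g_def Q_def peq)
  qed
  have pos: "AE x in lebesgue_on ?\<Omega>. rho_n \<theta> a b n x > 0"
  proof (subst AE_lebesgue_on_iff)
    show "AE x in lborel. x \<in> ?\<Omega> \<longrightarrow> 0 < rho_n \<theta> a b n x"
      using ae
    proof eventually_elim
      case (elim x)
      show ?case
      proof
        assume "x \<in> ?\<Omega>"
        then have "x \<in> Q" using interior_subset by blast
        moreover from this have "0 < fst x" by (auto simp: Q_def)
        ultimately show "0 < rho_n \<theta> a b n x" using elim ab by (simp add: c_def)
      qed
    qed
  qed simp
  have mass: "dist_deriv e_t (dist_of ?\<Omega> (rho_n \<theta> a b n)) \<phi>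
      + (\<Sum>j\<in>UNIV. dist_deriv (e_y j) (dist_of ?\<Omega> (\<lambda>x. rho_n \<theta> a b n x * u_n n x $ j)) \<phi>) = 0"
    if "\<phi> \<in> test_functions ?\<Omega>" for \<phi>
    by (rule weak_transport[OF that c cB ae])
  have inertia: "dist_deriv e_t (dist_of ?\<Omega> (\<lambda>x. rho_n \<theta> a b n x * u_n n x $ i)) \<phi>
      + (\<Sum>j\<in>UNIV. dist_deriv (e_y j)
          (dist_of ?\<Omega> (\<lambda>x. rho_n \<theta> a b n x * u_n n x $ i * u_n n x $ j)) \<phi>) = 0"
    if "\<phi> \<in> test_functions ?\<Omega>" for \<phi> i
  proof (rule weak_transport[OF that])
    \<comment> \<open>The momentum profile c(z) z_i is unbounded in z. The cutoff to the unit ball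
      repairs this and changes nothing on Q, where |y|/t < 1.\<close>
    let ?c = "\<lambda>z. c z * (indicator (ball 0 1) z * z $ i)"
    have "(\<lambda>z :: real^'d. z $ i) \<in> borel_measurable borel"
      by (intro borel_measurable_continuous_onI continuous_intros)
    then show "?c \<in> borel_measurable borel"
      by (intro borel_measurable_times c borel_measurable_indicator borel_open open_ball)
    show "\<bar>?c z\<bar> \<le> max a b * 1" for z
    proof -
      have "\<bar>indicator (ball 0 1) z * z $ i\<bar> \<le> 1"
        using component_le_norm_cart[of z i] by (auto split: split_indicator)
      then show ?thesis unfolding abs_mult[of "c z"] using cB[of z] by (intro mult_mono) auto
    qed
    show "AE x in lborel. x \<in> Q \<longrightarrow> rho_n \<theta> a b n x * u_n n x $ i
        = ?c (snd x /\<^sub>R fst x) / fst x ^ CARD('d)"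
      using ae
    proof eventually_elim
      case (elim x)
      have "snd x /\<^sub>R fst x \<in> ball 0 1" if "x \<in> Q"
        using that by (auto simp: Q_def field_simps)
      then show ?case using elim by (auto simp: u_n_def case_prod_beta')
    qed
  qed
  have pressure: "dist_deriv (e_y i) (dist_of ?\<Omega> (\<lambda>x. p (rho_n \<theta> a b n x))) \<phi> = 0"
    if "\<phi> \<in> test_functions ?\<Omega>" for \<phi> i
    using integral_time_profile_spatial_deriv[OF that g gB, of "axis i 1"]
    by (simp add: dist_deriv_def dist_of_bounded_version[OF test_function_dir_deriv[OF that] v_p])
  have stress: "dist_deriv (e_y j) (viscous_stress ?\<Omega> \<mu> lam (u_n n) i j) \<phi> = 0"
    if "\<phi> \<in> test_functions ?\<Omega>" for \<phi> i j
    by (simp add: dist_deriv_def viscous_stress_def velocity_second_derivative_eq_0[OF that])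
  show ?thesis
    unfolding weak_solution_NS_def
    using pos mass inertia pressure stress
      locally_integrable_bounded_version[OF v_rho]
      locally_integrable_bounded_version[OF v_p]
      locally_integrable_bounded_version[OF v_u]
      locally_integrable_bounded_version[OF bounded_version_on_Q_mult[OF v_rho v_u]]
      locally_integrable_bounded_version[OF bounded_version_on_Q_mult[OF bounded_version_on_Q_mult[OF v_rho v_u] v_u]]
    by simp
qed

theorem mainTheorem2:
  defines "d \<equiv> CARD('d)"
    and "QQ \<equiv> (Q :: (real \<times> (real^'d)) set)"
  shows
    "(\<forall>\<theta> \<mu> lam a b p. admissible d \<theta> a b p \<and> \<mu> > 0 \<and> lam + \<mu> > 0 \<longrightarrow>
        (\<forall>n\<ge>1. weak_solution_NS (interior QQ) \<mu> lam p (rho_n \<theta> a b n) (u_n n)) \<and>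
        Linf_strong_lim QQ (\<lambda>n. u_n (Suc n)) u_lim \<and>
        Linf_weak_star_lim QQ (\<lambda>n. rho_n \<theta> a b (Suc n)) (rho_lim \<theta> a b) \<and>
        is_young_measure QQ (\<lambda>n. rho_n \<theta> a b (Suc n)) (nu_lim \<theta> a b) \<and>
        (\<forall>\<nu>. is_young_measure QQ (\<lambda>n. rho_n \<theta> a b (Suc n)) \<nu> \<longrightarrow>
           (AE x in lebesgue_on QQ. \<nu> x = nu_lim \<theta> a b x)) \<and>
        (\<exists>q. Linf_weak_star_lim QQ (\<lambda>n x. p (rho_n \<theta> a b (Suc n) x)) q)) \<and>
     (\<exists>\<theta> a b p q. admissible d \<theta> a b p \<and>
        Linf_weak_star_lim QQ (\<lambda>n x. p (rho_n \<theta> a b (Suc n) x)) q \<and>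
        \<not> (AE x in lebesgue_on QQ. q x = p (rho_lim \<theta> a b x)))"
  unfolding d_def QQ_def
proof (intro conjI allI impI; (elim conjE)?)
  fix \<theta> \<mu> lam a b :: real and p :: "real \<Rightarrow> real"
  assume adm: "admissible CARD('d) \<theta> a b p"
  have theta: "0 < \<theta>" "\<theta> < 1" using adm by (auto simp: admissible_def)
  note ab = admissible_pos[OF adm]
  have p: "continuous_on {0<..} p" using adm by (simp add: admissible_def)
  show "weak_solution_NS (interior (Q :: (real \<times> (real^'d)) set)) \<mu> lam p (rho_n \<theta> a b n) (u_n n)"
    if "1 \<le> n" for n
    by (rule weak_solution_rho_n[OF adm that])
  show "Linf_strong_lim (Q :: (real \<times> (real^'d)) set) (\<lambda>n. u_n (Suc n)) u_lim"
    by (rule u_n_strong_lim)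
  have "rho_lim \<theta> a b = (\<lambda>x :: real \<times> (real^'d).
      \<theta> * (a / fst x ^ CARD('d)) + (1 - \<theta>) * (b / fst x ^ CARD('d)))"
    by (simp add: rho_lim_def case_prod_beta')
  then show "Linf_weak_star_lim (Q :: (real \<times> (real^'d)) set) (\<lambda>n. rho_n \<theta> a b (Suc n)) (rho_lim \<theta> a b)"
    using weak_star_rho_n(1)[OF theta ab continuous_on_id] by simp
  show young: "is_young_measure (Q :: (real \<times> (real^'d)) set) (\<lambda>n. rho_n \<theta> a b (Suc n)) (nu_lim \<theta> a b)"
    by (rule young_measure_rho_n[OF theta ab])
  show "AE x in lebesgue_on (Q :: (real \<times> (real^'d)) set). \<nu> x = nu_lim \<theta> a b x"
    if "is_young_measure Q (\<lambda>n. rho_n \<theta> a b (Suc n)) \<nu>" for \<nu>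
    by (rule young_measure_unique[OF that young])
  show "\<exists>q. Linf_weak_star_lim (Q :: (real \<times> (real^'d)) set) (\<lambda>n x. p (rho_n \<theta> a b (Suc n) x)) q"
    using weak_star_rho_n(1)[OF theta ab p] by blast
next
  show "\<exists>\<theta> a b p q. admissible CARD('d) \<theta> a b p \<and>
      Linf_weak_star_lim (Q :: (real \<times> (real^'d)) set) (\<lambda>n x. p (rho_n \<theta> a b (Suc n) x)) q \<and>
      \<not> (AE x in lebesgue_on Q. q x = p (rho_lim \<theta> a b x))"
    by (rule pressure_not_preserved)
qed

end
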